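(* Let $M$ be a matroid (on a finite ground set) without minors isomorphic to the Fano matroid or its dual, and let $\mathbb H$ be a finite WAM hyperfield. Then $$\left|\mathcal R^w_{\mathbb H}(M)\right|\le\left|X_{\mathbb H}\right|^{n_M},$$ where $\mathcal R^w_{\mathbb H}(M)$ is the set of rescaling classes of weak $\mathbb H$-matroids with underlying matroid $M$, $X_{\mathbb H}=\{(u,v)\in\mathbb H^*\times\mathbb H^*:1\in u\boxplus v\}$, and $n_M$ is the number of four-element sets $\{C_1,C_2,C_3,C_4\}$ of circuits of $M$ with $\dim(C_1\cup C_2\cup C_3\cup C_4)=1$.
   Context: A hyperfield is $(\mathbb H,\boxplus,\odot,0,1)$ with $0\ne1$ where: $\boxplus$ is a commutative, associative hyperoperation (each $a\boxplus b$ is a nonempty subset of $\mathbb H$; for subsets, $A\boxplus B=\bigcup_{a\in A,b\in B}a\boxplus b$) with $0\boxplus x=\{x\}$, each $x$ has a unique $-x$ with $0\in x\boxplus -x$, and $x\in y\boxplus z\iff z\in x\boxplus -y$; $(\mathbb H,\odot,1)$ is a commutative monoid, $0\odot x=0$, $a\odot(x\boxplus y)=(a\odot x)\boxplus(a\odot y)$; and $\mathbb H^*=\mathbb H\setminus\{0\}$ is a group under $\odot$. $\mathbb H$ is WAM if for all $f,g,\mu\in\mathbb H^*$ the simultaneous conditions $\mu\odot\mu=1$, $0\in1\boxplus f\boxplus g$, $0\in1\boxplus f\boxplus(\mu\odot g)$, $0\in1\boxplus(\mu\odot f)\boxplus g$, $0\in1\boxplus(\mu\odot f)\boxplus(\mu\odot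 g)$ imply $\mu=1$. For a union $F$ of circuits of $M$, $\dim F=|F|-\operatorname{rk}(F)-1$. Let $d$ be the rank and $E$ the ground set of $M$. A weak Grassmann–Plücker function of rank $d$ is a nonzero alternating $\varphi:E^d\to\mathbb H$ whose support is the set of bases of a matroid (its underlying matroid) and such that $0\in\boxplus_{k=1}^{d+1}(-1)^k\odot\varphi(x_1,\dots,\hat x_k,\dots,x_{d+1})\odot\varphi(x_k,y_1,\dots,y_{d-1})$ for all subsets $I=\{x_1,\dots,x_{d+1}\}$, $J=\{y_1,\dots,y_{d-1}\}$ of $E$ with $|I\setminus J|\le3$. $\mathcal R^w_{\mathbb H}(M)$ is the set of weak Grassmann–Plücker functions with underlying matroid $M$ modulo: $\varphi_1$ and $\varphi_2$ are equivalent iff there are $a\in\mathbb H^*$ and $h:E\to\mathbb H^*$ with $\varphi_1(x_1,\dots,x_d)=a\odot\left(\bigodot_{j=1}^dh(x_j)\right)\odot\varphi_2(x_1,\dots,x_d)$ for all $(x_1,\dots,x_d)\in E^d$. *)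

theory Defs
  imports "HOL-Algebra.FiniteProduct" "HOL-Combinatorics.Permutations"
begin

section \<open>Hyperfields\<close>

record 'h hyperstruct = "'h monoid" +
  hzero :: 'h
  hadd :: "'h \<Rightarrow> 'h \<Rightarrow> 'h set"  (infixl \<open>\<boxplus>\<index>\<close> 65)

definition hset_add :: "('h, 'm) hyperstruct_scheme \<Rightarrow> 'h set \<Rightarrow> 'h set \<Rightarrow> 'h set" where
  "hset_add H A B = (\<Union>a\<in>A. \<Union>b\<in>B. a \<boxplus>\<^bsub>H\<^esub> b)"

definition hunits :: "('h, 'm) hyperstruct_scheme \<Rightarrow> 'h set" where
  "hunits H = carrier H - {hzero H}"

definition hneg :: "('h, 'm) hyperstruct_scheme \<Rightarrow> 'h \<Rightarrow> 'h" where
  "hneg H x = (THE y. y \<in> carrier H \<and> hzero H \<in> x \<boxplus>\<^bsub>H\<^esub> y)"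

definition hsum :: "('h, 'm) hyperstruct_scheme \<Rightarrow> 'h list \<Rightarrow> 'h set" where
  "hsum H as = foldr (\<lambda>a S. hset_add H {a} S) as {hzero H}"

locale hyperfield = comm_monoid H for H :: "('h, 'm) hyperstruct_scheme" (structure) +
  assumes hzero_closed: "hzero H \<in> carrier H"
    and hzero_neq_one: "hzero H \<noteq> \<one>"
    and hadd_closed: "\<lbrakk>x \<in> carrier H; y \<in> carrier H\<rbrakk> \<Longrightarrow> x \<boxplus> y \<subseteq> carrier H"
    and hadd_nonempty: "\<lbrakk>x \<in> carrier H; y \<in> carrier H\<rbrakk> \<Longrightarrow> x \<boxplus> y \<noteq> {}"
    and hadd_commute: "\<lbrakk>x \<in> carrier H; y \<in> carrier H\<rbrakk> \<Longrightarrow> x \<boxplus> y = y \<boxplus> x"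
    and hadd_assoc: "\<lbrakk>x \<in> carrier H; y \<in> carrier H; z \<in> carrier H\<rbrakk> \<Longrightarrow>
          hset_add H (x \<boxplus> y) {z} = hset_add H {x} (y \<boxplus> z)"
    and hadd_zero: "x \<in> carrier H \<Longrightarrow> hzero H \<boxplus> x = {x}"
    and hneg_ex1: "x \<in> carrier H \<Longrightarrow> \<exists>!y. y \<in> carrier H \<and> hzero H \<in> x \<boxplus> y"
    and hadd_reversible: "\<lbrakk>x \<in> carrier H; y \<in> carrier H; z \<in> carrier H\<rbrakk> \<Longrightarrow>
          x \<in> y \<boxplus> z \<longleftrightarrow> z \<in> x \<boxplus> hneg H y"
    and hzero_mult: "x \<in> carrier H \<Longrightarrow> hzero H \<otimes> x = hzero H"
    and hdistrib: "\<lbrakk>a \<in> carrier H; x \<in> carrier H; y \<in> carrier H\<rbrakk> \<Longrightarrow>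
          (\<lambda>t. a \<otimes> t) ` (x \<boxplus> y) = (a \<otimes> x) \<boxplus> (a \<otimes> y)"
    and hunits_group: "group (H\<lparr>carrier := hunits H\<rparr>)"

locale wam_hyperfield = hyperfield +
  assumes wam: "\<lbrakk>f \<in> hunits H; g \<in> hunits H; \<mu> \<in> hunits H; \<mu> \<otimes> \<mu> = \<one>;
      hzero H \<in> hsum H [\<one>, f, g];
      hzero H \<in> hsum H [\<one>, f, \<mu> \<otimes> g];
      hzero H \<in> hsum H [\<one>, \<mu> \<otimes> f, g];
      hzero H \<in> hsum H [\<one>, \<mu> \<otimes> f, \<mu> \<otimes> g]\<rbrakk> \<Longrightarrow> \<mu> = \<one>"

definition X_set :: "('h, 'm) hyperstruct_scheme \<Rightarrow> ('h \<times> 'h) set" where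
  "X_set H = {(u, v). u \<in> hunits H \<and> v \<in> hunits H \<and> \<one>\<^bsub>H\<^esub> \<in> u \<boxplus>\<^bsub>H\<^esub> v}"


section \<open>Matroids\<close>

record 'a indep_system =
  ground :: "'a set"
  indep :: "'a set set"

locale matroid =
  fixes M :: "'a indep_system"
  assumes finite_ground: "finite (ground M)"
    and indep_ground: "I \<in> indep M \<Longrightarrow> I \<subseteq> ground M"
    and indep_empty: "{} \<in> indep M"
    and indep_mono: "\<lbrakk>I \<in> indep M; J \<subseteq> I\<rbrakk> \<Longrightarrow> J \<in> indep M"
    and indep_augment: "\<lbrakk>I \<in> indep M; J \<in> indep M; card I < card J\<rbrakk> \<Longrightarrow>
          \<exists>x\<in>J - I. insert x I \<in> indep M"

definition bases :: "'a indep_system \<Rightarrow> 'a set set" where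
  "bases M = {B \<in> indep M. \<forall>I\<in>indep M. B \<subseteq> I \<longrightarrow> I = B}"

definition circuits :: "'a indep_system \<Rightarrow> 'a set set" where
  "circuits M = {C. C \<subseteq> ground M \<and> C \<notin> indep M \<and> (\<forall>D. D \<subset> C \<longrightarrow> D \<in> indep M)}"

definition rk :: "'a indep_system \<Rightarrow> 'a set \<Rightarrow> nat" where
  "rk M X = Max (card ` {I \<in> indep M. I \<subseteq> X})"

definition union_dim :: "'a indep_system \<Rightarrow> 'a set \<Rightarrow> int" where
  "union_dim M F = int (card F) - int (rk M F) - 1"

definition dual_matroid :: "'a indep_system \<Rightarrow> 'a indep_system" where
  "dual_matroid M = \<lparr>ground = ground M, indep = {I. \<exists>B\<in>bases M. I \<subseteq> ground M - B}\<rparr>"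

definition delete :: "'a indep_system \<Rightarrow> 'a set \<Rightarrow> 'a indep_system" where
  "delete M D = \<lparr>ground = ground M - D, indep = {I \<in> indep M. I \<subseteq> ground M - D}\<rparr>"

definition contract :: "'a indep_system \<Rightarrow> 'a set \<Rightarrow> 'a indep_system" where
  "contract M C = \<lparr>ground = ground M - C,
     indep = {I. I \<subseteq> ground M - C \<and> rk M (I \<union> C) = card I + rk M C}\<rparr>"

definition is_minor :: "'a indep_system \<Rightarrow> 'a indep_system \<Rightarrow> bool" where
  "is_minor N M \<longleftrightarrow> (\<exists>C D. C \<subseteq> ground M \<and> D \<subseteq> ground M \<and> C \<inter> D = {} \<and>
     N = delete (contract M C) D)"

definition matroid_isomorphic :: "'a indep_system \<Rightarrow> 'b indep_system \<Rightarrow> bool" where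
  "matroid_isomorphic M N \<longleftrightarrow> (\<exists>f. bij_betw f (ground M) (ground N) \<and>
     (\<forall>I\<subseteq>ground M. I \<in> indep M \<longleftrightarrow> f ` I \<in> indep N))"

definition fano :: "nat indep_system" where
  "fano = \<lparr>ground = {1..7},
     indep = {I. I \<subseteq> {1..7} \<and> card I \<le> 3 \<and>
       I \<notin> {{1,2,4}, {2,3,5}, {3,4,6}, {4,5,7}, {1,5,6}, {2,6,7}, {1,3,7}}}\<rparr>"

definition num_dim1_quads :: "'a indep_system \<Rightarrow> nat" where
  "num_dim1_quads M = card {\<C>. \<C> \<subseteq> circuits M \<and> card \<C> = 4 \<and> union_dim M (\<Union>\<C>) = 1}"


section \<open>Weak Grassmann--Pluecker functions and rescaling classes\<close>

definition tuples :: "'a set \<Rightarrow> nat \<Rightarrow> 'a list set" where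
  "tuples E d = {xs. set xs \<subseteq> E \<and> length xs = d}"

definition alternating ::
    "('h, 'm) hyperstruct_scheme \<Rightarrow> 'a set \<Rightarrow> nat \<Rightarrow> ('a list \<Rightarrow> 'h) \<Rightarrow> bool" where
  "alternating H E d \<phi> \<longleftrightarrow>
     (\<forall>xs\<in>tuples E d. \<not> distinct xs \<longrightarrow> \<phi> xs = hzero H) \<and>
     (\<forall>xs\<in>tuples E d. \<forall>\<sigma>. \<sigma> permutes {..<d} \<longrightarrow>
        \<phi> (permute_list \<sigma> xs) = (if evenperm \<sigma> then \<phi> xs else hneg H (\<phi> xs)))"

text \<open>With 0-based list indices, the usual sign at position \<open>k\<close> becomes the \<open>Suc k\<close>-th power.\<close>

definition gp_terms ::
    "('h, 'm) hyperstruct_scheme \<Rightarrow> ('a list \<Rightarrow> 'h) \<Rightarrow> 'a list \<Rightarrow> 'a list \<Rightarrow> 'h list" where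
  "gp_terms H \<phi> xs ys = map (\<lambda>k.
     (hneg H \<one>\<^bsub>H\<^esub> [^]\<^bsub>H\<^esub> Suc k) \<otimes>\<^bsub>H\<^esub> \<phi> (take k xs @ drop (Suc k) xs) \<otimes>\<^bsub>H\<^esub> \<phi> (xs ! k # ys))
     [0..<length xs]"

text \<open>Functions on \<open>E\<^sup>d\<close> are extensional (undefined off \<open>tuples E d\<close>), so that equality of
  them, and hence counting, is as on \<open>E\<^sup>d\<close>. Writing \<open>length ys + 1 = d\<close> makes the
  Grassmann--Pluecker condition vacuous in rank 0, where there is no set of size \<open>d - 1\<close>.\<close>

definition weak_GP :: "('h, 'm) hyperstruct_scheme \<Rightarrow> 'a indep_system \<Rightarrow> ('a list \<Rightarrow> 'h) set" where
  "weak_GP H M = (let E = ground M; d = rk M (ground M) in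
     {\<phi> \<in> tuples E d \<rightarrow>\<^sub>E carrier H.
        (\<exists>xs\<in>tuples E d. \<phi> xs \<noteq> hzero H) \<and>
        alternating H E d \<phi> \<and>
        set ` {xs \<in> tuples E d. \<phi> xs \<noteq> hzero H} = bases M \<and>
        (\<forall>xs ys. set xs \<subseteq> E \<and> set ys \<subseteq> E \<and> distinct xs \<and> distinct ys \<and>
           length xs = d + 1 \<and> length ys + 1 = d \<and> card (set xs - set ys) \<le> 3 \<longrightarrow>
           hzero H \<in> hsum H (gp_terms H \<phi> xs ys))})"

definition rescaling_rel ::
    "('h, 'm) hyperstruct_scheme \<Rightarrow> 'a indep_system \<Rightarrow> (('a list \<Rightarrow> 'h) \<times> ('a list \<Rightarrow> 'h)) set" where
  "rescaling_rel H M = (let E = ground M; d = rk M (ground M) in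
     {(\<phi>1, \<phi>2). \<phi>1 \<in> weak_GP H M \<and> \<phi>2 \<in> weak_GP H M \<and>
        (\<exists>a\<in>hunits H. \<exists>h\<in>E \<rightarrow> hunits H. \<forall>xs\<in>tuples E d.
           \<phi>1 xs = a \<otimes>\<^bsub>H\<^esub> (\<Otimes>\<^bsub>H\<^esub>j\<in>{..<d}. h (xs ! j)) \<otimes>\<^bsub>H\<^esub> \<phi>2 xs)})"

definition rescaling_classes ::
    "('h, 'm) hyperstruct_scheme \<Rightarrow> 'a indep_system \<Rightarrow> ('a list \<Rightarrow> 'h) set set" where
  "rescaling_classes H M = weak_GP H M // rescaling_rel H M"

text \<open>The sets that are counted are finite, so \<open>card\<close> carries its usual meaning, and
  rescaling is an equivalence relation.\<close>

lemma finite_tuples: "finite E \<Longrightarrow> finite (tuples E d)"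
  unfolding tuples_def by (rule finite_lists_length_eq)

lemma finite_rescaling_classes:
  assumes "matroid M" "finite (carrier H)"
  shows "finite (rescaling_classes H M)"
proof -
  have "finite (tuples (ground M) (rk M (ground M)) \<rightarrow>\<^sub>E carrier H)"
    using assms by (intro finite_PiE finite_tuples) (auto simp: matroid_def)
  then have "finite (weak_GP H M)"
    by (rule rev_finite_subset) (auto simp: weak_GP_def Let_def)
  then show ?thesis
    unfolding rescaling_classes_def
    by (rule finite_quotient) (auto simp: rescaling_rel_def Let_def)
qed

lemma finite_X_set: "finite (carrier H) \<Longrightarrow> finite (X_set H)"
  by (rule finite_subset[of _ "carrier H \<times> carrier H"]) (auto simp: X_set_def hunits_def)

lemma finite_dim1_quads:
  assumes "matroid M"
  shows "finite {\<C>. \<C> \<subseteq> circuits M \<and> card \<C> = 4 \<and> union_dim M (\<Union>\<C>) = 1}"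
proof -
  have "circuits M \<subseteq> Pow (ground M)"
    by (auto simp: circuits_def)
  then have "finite (circuits M)"
    using assms by (auto simp: matroid_def intro: finite_subset)
  then show ?thesis
    by (auto intro: finite_subset[of _ "Pow (circuits M)"])
qed

lemma equiv_rescaling_rel:
  fixes H (structure)
  assumes "hyperfield H"
  shows "equiv (weak_GP H M) (rescaling_rel H M)"
proof -
  interpret hyperfield H by fact
  define E where "E = ground M"
  define d where "d = rk M (ground M)"
  let ?G = "H\<lparr>carrier := hunits H\<rparr>"
  interpret G: group ?G by (rule hunits_group)
  have uc: "x \<in> carrier H" if "x \<in> hunits H" for x
    using that by (simp add: hunits_def)
  have um: "x \<otimes> y \<in> hunits H" if "x \<in> hunits H" "y \<in> hunits H" for x y
    using G.m_closed that by simp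
  have u1: "\<one> \<in> hunits H"
    using G.one_closed by simp
  have inv_ex: "\<exists>y\<in>hunits H. y \<otimes> x = \<one>" if "x \<in> hunits H" for x
    using G.l_inv_ex that by simp
  have nth: "xs ! j \<in> E" if "xs \<in> tuples E d" "j \<in> {..<d}" for xs j
    using that by (auto simp: tuples_def)
  have val: "\<phi> xs \<in> carrier H" if "\<phi> \<in> weak_GP H M" "xs \<in> tuples E d" for \<phi> xs
    using that by (auto simp: weak_GP_def Let_def E_def d_def)
  have relI: "(\<phi>, \<psi>) \<in> rescaling_rel H M"
    if "\<phi> \<in> weak_GP H M" "\<psi> \<in> weak_GP H M" "a \<in> hunits H" "h \<in> E \<rightarrow> hunits H"
      "\<And>xs. xs \<in> tuples E d \<Longrightarrow> \<phi> xs = a \<otimes> (\<Otimes>j\<in>{..<d}. h (xs ! j)) \<otimes> \<psi> xs" for \<phi> \<psi> a h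
    using that unfolding rescaling_rel_def Let_def E_def d_def by blast
  have relE: "\<exists>a h. \<phi> \<in> weak_GP H M \<and> \<psi> \<in> weak_GP H M \<and> a \<in> hunits H \<and> h \<in> E \<rightarrow> hunits H \<and>
      (\<forall>xs\<in>tuples E d. \<phi> xs = a \<otimes> (\<Otimes>j\<in>{..<d}. h (xs ! j)) \<otimes> \<psi> xs)"
    if "(\<phi>, \<psi>) \<in> rescaling_rel H M" for \<phi> \<psi>
    using that unfolding rescaling_rel_def Let_def E_def d_def by blast
  have prodc: "(\<lambda>j. h (xs ! j)) \<in> {..<d} \<rightarrow> carrier H"
    if "h \<in> E \<rightarrow> hunits H" "xs \<in> tuples E d" for h xs
    using that nth uc by blast
  have "refl_on (weak_GP H M) (rescaling_rel H M)"
  proof (rule refl_onI)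
    fix \<phi> assume \<phi>: "\<phi> \<in> weak_GP H M"
    show "(\<phi>, \<phi>) \<in> rescaling_rel H M"
      by (rule relI[OF \<phi> \<phi> u1, of "\<lambda>_. \<one>"]) (use u1 val[OF \<phi>] in auto)
  qed
  moreover have "sym (rescaling_rel H M)"
  proof (rule symI)
    fix \<phi> \<psi> assume "(\<phi>, \<psi>) \<in> rescaling_rel H M"
    then obtain a h where *: "\<phi> \<in> weak_GP H M" "\<psi> \<in> weak_GP H M" "a \<in> hunits H"
        "h \<in> E \<rightarrow> hunits H"
        "\<forall>xs\<in>tuples E d. \<phi> xs = a \<otimes> (\<Otimes>j\<in>{..<d}. h (xs ! j)) \<otimes> \<psi> xs"
      using relE by blast
    obtain b where b: "b \<in> hunits H" "b \<otimes> a = \<one>" using inv_ex[OF *(3)] by blast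
    have "\<forall>x\<in>E. \<exists>y. y \<in> hunits H \<and> y \<otimes> h x = \<one>" using inv_ex *(4) by blast
    then obtain k where k: "\<forall>x\<in>E. k x \<in> hunits H \<and> k x \<otimes> h x = \<one>" by metis
    then have kE: "k \<in> E \<rightarrow> hunits H" by blast
    show "(\<psi>, \<phi>) \<in> rescaling_rel H M"
    proof (rule relI[OF *(2,1) b(1) kE])
      fix xs assume xs: "xs \<in> tuples E d"
      let ?P = "\<Otimes>j\<in>{..<d}. h (xs ! j)" and ?Q = "\<Otimes>j\<in>{..<d}. k (xs ! j)"
      have PQ: "?P \<in> carrier H" "?Q \<in> carrier H"
        using finprod_closed prodc[OF *(4) xs] prodc[OF kE xs] by blast+
      have "?Q \<otimes> ?P = (\<Otimes>j\<in>{..<d}. k (xs ! j) \<otimes> h (xs ! j))"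
        by (rule finprod_multf[symmetric]) (use prodc[OF *(4) xs] prodc[OF kE xs] in auto)
      also have "\<dots> = \<one>"
        using k nth[OF xs] by (intro finprod_one_eqI) auto
      finally have QP: "?Q \<otimes> ?P = \<one>" .
      have c: "a \<in> carrier H" "b \<in> carrier H" "\<psi> xs \<in> carrier H"
        using uc * b val xs by auto
      have "b \<otimes> ?Q \<otimes> (a \<otimes> ?P \<otimes> \<psi> xs) = (b \<otimes> a) \<otimes> (?Q \<otimes> ?P) \<otimes> \<psi> xs"
        using c PQ by (simp add: m_ac)
      then show "\<psi> xs = b \<otimes> ?Q \<otimes> \<phi> xs"
        using *(5) xs b(2) QP c by simp
    qed
  qed
  moreover have "trans (rescaling_rel H M)"
  proof (rule transI)
    fix \<phi> \<psi> \<chi> assume 1: "(\<phi>, \<psi>) \<in> rescaling_rel H M" and 2: "(\<psi>, \<chi>) \<in> rescaling_rel H M"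
    obtain a h where *: "\<phi> \<in> weak_GP H M" "\<psi> \<in> weak_GP H M" "a \<in> hunits H"
        "h \<in> E \<rightarrow> hunits H"
        "\<forall>xs\<in>tuples E d. \<phi> xs = a \<otimes> (\<Otimes>j\<in>{..<d}. h (xs ! j)) \<otimes> \<psi> xs"
      using relE[OF 1] by blast
    obtain b k where **: "\<chi> \<in> weak_GP H M" "b \<in> hunits H"
        "k \<in> E \<rightarrow> hunits H"
        "\<forall>xs\<in>tuples E d. \<psi> xs = b \<otimes> (\<Otimes>j\<in>{..<d}. k (xs ! j)) \<otimes> \<chi> xs"
      using relE[OF 2] by blast
    have hk: "(\<lambda>x. h x \<otimes> k x) \<in> E \<rightarrow> hunits H" using *(4) **(3) um by blast
    show "(\<phi>, \<chi>) \<in> rescaling_rel H M"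
    proof (rule relI[OF *(1) **(1) um[OF *(3) **(2)] hk])
      fix xs assume xs: "xs \<in> tuples E d"
      let ?P = "\<Otimes>j\<in>{..<d}. h (xs ! j)" and ?Q = "\<Otimes>j\<in>{..<d}. k (xs ! j)"
      have PQ: "?P \<in> carrier H" "?Q \<in> carrier H"
        using finprod_closed prodc[OF *(4) xs] prodc[OF **(3) xs] by blast+
      have e: "(\<Otimes>j\<in>{..<d}. h (xs ! j) \<otimes> k (xs ! j)) = ?P \<otimes> ?Q"
        by (rule finprod_multf) (use prodc[OF *(4) xs] prodc[OF **(3) xs] in auto)
      have c: "a \<in> carrier H" "b \<in> carrier H" "\<chi> xs \<in> carrier H"
        using uc * ** val xs by auto
      show "\<phi> xs = a \<otimes> b \<otimes> (\<Otimes>j\<in>{..<d}. h (xs ! j) \<otimes> k (xs ! j)) \<otimes> \<chi> xs"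
        unfolding e using *(5) **(4) xs c PQ by (simp add: m_ac)
    qed
  qed
  moreover have "rescaling_rel H M \<subseteq> weak_GP H M \<times> weak_GP H M"
    by (auto simp: rescaling_rel_def Let_def)
  ultimately show ?thesis
    by (simp add: equiv_def)
qed

end

theory Submission
  imports Defs
begin

text \<open>Let \<open>\<phi>\<^sub>1\<close> and \<open>\<phi>\<^sub>2\<close> be weak Grassmann--Pluecker functions of \<open>M\<close> whose cross ratios agree.
  Their quotient \<open>\<psi>\<close> is a function on bases with values in the group of units and
  \<open>\<psi>(Jab) \<psi>(Jcd) = \<psi>(Jac) \<psi>(Jbd)\<close> whenever these four sets are bases. For a basis \<open>B\<close>, weight the
  edges \<open>b\<close>--\<open>e\<close> of its fundamental graph by \<open>\<psi>(B - b + e) / \<psi>(B)\<close>. Four-cycles have trivial weight,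
  and a longer chordless closed walk becomes shorter, with the same weight, after a pivot on one of its
  edges. So all closed walks are trivial and the weights come from a potential \<open>h\<close>. The same \<open>h\<close> serves
  all bases, which makes \<open>\<psi>(B)\<close> a constant times \<open>\<Prod>\<^sub>B h\<close>.

  When \<open>Jad\<close> or \<open>Jbc\<close> is not a basis, the identity for \<open>\<psi>\<close> is a three-term Grassmann--Pluecker relation
  with only two nonzero terms. Otherwise it says that a cross ratio of \<open>\<psi>\<close> is trivial, and this depends only
  on the four circuits of \<open>J \<union> {a, b, c, d}\<close> which miss one of \<open>a, b, c, d\<close>. So a rescaling class is
  determined by one cross ratio, an element of \<open>X\<^sub>H\<close>, for every quadruple of circuits of dimension 1.\<close>

section \<open>Matroids\<close>

text \<open>The quotient \<open>\<psi>\<close> lives in the abelian group of units, so hyperaddition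
  enters only through three-term relations. When one term vanishes, such a relation is an equation,
  and the same equation up to sign for both functions; these equations are all that is known before
  cross ratios are compared.

  Let F be the union of a quadruple \<open>q\<close>. Its dimension is 1, so the dual of the
  restriction to F has rank two, and the four sets F - C for C in \<open>q\<close> are parallel
  classes of it: four points on a line, which is why a cross ratio belongs to \<open>q\<close>. A
  larger set S of the same nullity adds only coloops. Hence changing an element inside its class, or
  changing S, meets a pair of elements whose complement in S is no basis, and the resulting two-term
  relation shows that triviality of the cross ratio survives the change.

  Exchanges obey the rules for 2 by 2 minors of a matrix with rows \<open>B\<close> and columns
  outside \<open>B\<close>. A pivot keeps the weight of an edge disjoint from the pivot edge unless
  the two edges span a four-cycle. This is why the closed walk must have no chords. A cross ratio is
  a pair because in a hyperfield \<open>u\<close> does not determine \<open>v\<close> in \<one>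
  \<in> u \<boxplus> v.\<close>

context matroid
begin

lemma finite_indep: "I \<in> indep M \<Longrightarrow> finite I"
  using finite_ground indep_ground finite_subset by blast

lemma finite_indep_set: "finite (indep M)"
  using finite_ground indep_ground by (auto intro: finite_subset[of _ "Pow (ground M)"])

lemma card_le_rk: "I \<in> indep M \<Longrightarrow> I \<subseteq> X \<Longrightarrow> card I \<le> rk M X"
  unfolding rk_def using finite_indep_set by (intro Max_ge) auto

lemma rk_witness: obtains I where "I \<in> indep M" "I \<subseteq> X" "card I = rk M X"
proof -
  have "rk M X \<in> card ` {I \<in> indep M. I \<subseteq> X}"
    unfolding rk_def using finite_indep_set indep_empty by (intro Max_in) auto
  then show ?thesis using that by auto
qed

lemma rk_mono: "X \<subseteq> Y \<Longrightarrow> rk M X \<le> rk M Y"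
  by (metis rk_witness card_le_rk subset_trans)

lemma rk_le_card: "finite X \<Longrightarrow> rk M X \<le> card X"
  by (metis rk_witness card_mono)

lemma indep_extend:
  assumes "I \<in> indep M" "K \<in> indep M" "card I \<le> card K"
  obtains I' where "I' \<in> indep M" "I \<subseteq> I'" "I' \<subseteq> I \<union> K" "card I' = card K"
proof -
  have "\<exists>I'. I' \<in> indep M \<and> I \<subseteq> I' \<and> I' \<subseteq> I \<union> K \<and> card I' = card K"
    using assms
  proof (induction "card K - card I" arbitrary: I)
    case 0
    then show ?case by (intro exI[of _ I]) auto
  next
    case (Suc n)
    then have "card I < card K" by linarith
    then obtain x where x: "x \<in> K - I" "insert x I \<in> indep M"
      using indep_augment[of I K] Suc.prems by blast
    have "card (insert x I) = Suc (card I)"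
      using x Suc.prems finite_indep by simp
    then have "n = card K - card (insert x I)" "card (insert x I) \<le> card K"
      using Suc.hyps(2) by linarith+
    from Suc.hyps(1)[OF this(1) x(2) Suc.prems(2) this(2)] x show ?case by blast
  qed
  then show ?thesis using that by blast
qed

lemma bases_iff: "B \<in> bases M \<longleftrightarrow> B \<in> indep M \<and> card B = rk M (ground M)"
proof
  assume B: "B \<in> bases M"
  obtain K where K: "K \<in> indep M" "card K = rk M (ground M)" by (metis rk_witness)
  have i: "B \<in> indep M" and le: "card B \<le> card K"
    using B K card_le_rk indep_ground by (auto simp: bases_def)
  obtain I where "I \<in> indep M" "B \<subseteq> I" "card I = card K"
    using indep_extend[OF i K(1) le] by metis
  then show "B \<in> indep M \<and> card B = rk M (ground M)"
    using B K i by (auto simp: bases_def)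
next
  assume B: "B \<in> indep M \<and> card B = rk M (ground M)"
  have "I = B" if "I \<in> indep M" "B \<subseteq> I" for I
    using that B card_le_rk[of I "ground M"] indep_ground finite_indep card_seteq[of I B] by auto
  then show "B \<in> bases M" using B by (auto simp: bases_def)
qed

lemma basis_subset_ground: "B \<in> bases M \<Longrightarrow> B \<subseteq> ground M"
  using bases_iff indep_ground by blast

lemma finite_basis: "B \<in> bases M \<Longrightarrow> finite B"
  using bases_iff finite_indep by blast

lemma card_basis: "B \<in> bases M \<Longrightarrow> card B = rk M (ground M)"
  using bases_iff by blast

lemma basisI_rk:
  assumes "finite X" "card X = rk M (ground M)" "rk M X = rk M (ground M)"
  shows "X \<in> bases M"
proof -
  obtain I where "I \<in> indep M" "I \<subseteq> X" "card I = rk M X" by (rule rk_witness)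
  then show ?thesis using assms bases_iff card_subset_eq by metis
qed

lemma basis_exchange:
  assumes "B \<in> bases M" "B' \<in> bases M" "b \<in> B" "b \<notin> B'"
  obtains e where "e \<in> B'" "e \<notin> B" "insert e (B - {b}) \<in> bases M"
proof -
  have fin: "finite B" using assms finite_basis by auto
  have i: "B - {b} \<in> indep M" "B' \<in> indep M"
    using assms(1,2) bases_iff indep_mono[of B "B - {b}"] by auto
  have c: "card (B - {b}) < card B'"
    using assms card_basis fin by (metis card_Diff1_less)
  obtain e where e: "e \<in> B' - (B - {b})" "insert e (B - {b}) \<in> indep M"
    using indep_augment[OF i c] by blast
  then have "e \<noteq> b" "e \<notin> B" using assms by auto
  moreover have "card (insert e (B - {b})) = card B"
    using fin assms(3) \<open>e \<notin> B\<close> card_Suc_Diff1[of B b] by (simp del: card_Diff_insert card_Diff_singleton)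
  ultimately show ?thesis using that e assms bases_iff by auto
qed

text \<open>After contracting \<open>J\<close> the rank is two and \<open>z\<close> is not a loop.
  Being parallel is transitive, so \<open>z\<close> cannot be parallel to both \<open>x\<close> and
  \<open>y\<close>, which are independent.\<close>

lemma basis_pair_exchange:
  assumes "insert x (insert y J) \<in> bases M" "insert z (insert w J) \<in> bases M"
    and "insert z (insert x J) \<notin> bases M"
    and "distinct [x, y, z, w]" "{x, y, z, w} \<inter> J = {}"
  shows "insert z (insert y J) \<in> bases M"
proof -
  have fin: "finite J" using finite_basis[OF assms(1)] by simp
  have i: "insert z J \<in> indep M" "insert x (insert y J) \<in> indep M"
    using assms(1,2) bases_iff indep_mono[of "insert z (insert w J)" "insert z J"] by auto
  have "card (insert z J) < card (insert x (insert y J))" using assms fin by simp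
  then obtain u where u: "u \<in> insert x (insert y J) - insert z J" "insert u (insert z J) \<in> indep M"
    using indep_augment[OF i] by blast
  have c: "card (insert u (insert z J)) = card (insert x (insert y J))"
    using assms fin u by auto
  have "insert u (insert z J) \<in> bases M" using u c assms(1) bases_iff by auto
  moreover have "u = x \<or> u = y" using u by auto
  ultimately show ?thesis using assms(3) by (auto simp: insert_commute)
qed

section \<open>Circuits and rank\<close>

lemma circuit_indep_diff: "C \<in> circuits M \<Longrightarrow> x \<in> C \<Longrightarrow> C - {x} \<in> indep M"
  unfolding circuits_def by blast

lemma circuit_not_subset_indep: "C \<in> circuits M \<Longrightarrow> I \<in> indep M \<Longrightarrow> \<not> C \<subseteq> I"
  unfolding circuits_def using indep_mono by blast

lemma circuit_not_subset_basis: "C \<in> circuits M \<Longrightarrow> B \<in> bases M \<Longrightarrow> \<not> C \<subseteq> B"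
  using circuit_not_subset_indep bases_iff by blast

lemma circuit_antichain: "C \<in> circuits M \<Longrightarrow> C' \<in> circuits M \<Longrightarrow> C \<subseteq> C' \<Longrightarrow> C = C'"
  unfolding circuits_def by blast

lemma circuit_nonempty: "C \<in> circuits M \<Longrightarrow> C \<noteq> {}"
  using indep_empty unfolding circuits_def by blast

text \<open>A maximal independent subset of \<open>X\<close> that extends \<open>C - {x}\<close>
  cannot contain \<open>x\<close>, since it would then contain \<open>C\<close>.\<close>

lemma rk_diff_circuit_elem:
  assumes "C \<in> circuits M" "x \<in> C" "C \<subseteq> X"
  shows "rk M (X - {x}) = rk M X"
proof (rule antisym)
  show "rk M (X - {x}) \<le> rk M X" by (rule rk_mono) auto
  obtain I where I: "I \<in> indep M" "I \<subseteq> X" "card I = rk M X" by (rule rk_witness)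
  have i: "C - {x} \<in> indep M" using circuit_indep_diff assms by blast
  have "card (C - {x}) \<le> card I" using I card_le_rk[OF i] assms(3) by (metis Diff_subset subset_trans)
  from indep_extend[OF i I(1) this] obtain I' where
    I': "I' \<in> indep M" "C - {x} \<subseteq> I'" "I' \<subseteq> C - {x} \<union> I" "card I' = card I" .
  have "x \<notin> I'" using I' circuit_not_subset_indep[OF assms(1)] by blast
  then have "I' \<subseteq> X - {x}" using I I' assms by blast
  then show "rk M X \<le> rk M (X - {x})" using card_le_rk[OF I'(1)] I I' by auto
qed

lemma dependent_circuit:
  assumes "X \<subseteq> ground M" "X \<notin> indep M"
  obtains C where "C \<in> circuits M" "C \<subseteq> X"
proof -
  have fin: "finite X" using assms finite_ground finite_subset by blast
  define A where "A = {Y. Y \<subseteq> X \<and> Y \<notin> indep M}"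
  have "finite A" "A \<noteq> {}" using fin assms by (auto simp: A_def)
  then obtain C where C: "C \<in> A" "\<forall>D\<in>A. D \<subseteq> C \<longrightarrow> D = C"
    using finite_has_minimal[of A] by metis
  have "D \<in> indep M" if "D \<subset> C" for D using C that by (auto simp: A_def)
  then have "C \<in> circuits M" using C assms by (auto simp: A_def circuits_def)
  then show ?thesis using that C by (auto simp: A_def)
qed

end

section \<open>Quadruples of circuits of nullity two\<close>

locale circuit_quad = matroid M for M :: "'a indep_system" +
  fixes q
  assumes q_circuits: "q \<subseteq> circuits M"
    and q_card: "card q = 4"
    and q_dim: "union_dim M (\<Union>q) = 1"
begin

lemma quad_union_ground: "\<Union>q \<subseteq> ground M"
  using q_circuits by (auto simp: circuits_def)

lemma finite_quad_union: "finite (\<Union>q)"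
  using quad_union_ground finite_ground finite_subset by blast

lemma rk_quad_union: "card (\<Union>q) = rk M (\<Union>q) + 2"
  using q_dim unfolding union_dim_def by linarith

text \<open>The union has nullity two, so at most two elements can be deleted without loss of rank.
  If \<open>x\<close> missed both circuits, three could: \<open>x\<close>, then some
  \<open>y\<close> in \<open>C - C'\<close>, then some \<open>z\<close> in \<open>C'\<close>, each
  on a circuit that is still present. Consequently the sets \<open>\<Union>q - C\<close> for
  \<open>C\<close> in \<open>q\<close> are pairwise disjoint.\<close>

lemma quad_cover:
  assumes "C \<in> q" "C' \<in> q" "C \<noteq> C'" "x \<in> \<Union>q" "x \<notin> C"
  shows "x \<in> C'"
proof (rule ccontr)
  assume "x \<notin> C'"
  let ?F = "\<Union>q"
  have circ: "C \<in> circuits M" "C' \<in> circuits M" using assms q_circuits by auto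
  obtain C'' where C'': "C'' \<in> q" "x \<in> C''" using assms by auto
  have r1: "rk M (?F - {x}) = rk M ?F"
    using C'' q_circuits by (intro rk_diff_circuit_elem[of C'']) auto
  obtain y where y: "y \<in> C" "y \<notin> C'" using circuit_antichain circ assms by blast
  have r2: "rk M (?F - {x} - {y}) = rk M (?F - {x})"
    using y circ assms by (intro rk_diff_circuit_elem[of C]) auto
  obtain z where z: "z \<in> C'" using circuit_nonempty circ by blast
  have r3: "rk M (?F - {x} - {y} - {z}) = rk M (?F - {x} - {y})"
    using y z circ assms \<open>x \<notin> C'\<close> by (intro rk_diff_circuit_elem[of C']) auto
  have d: "x \<noteq> y" "x \<noteq> z" "y \<noteq> z" "y \<in> ?F" "z \<in> ?F"
    using y z assms \<open>x \<notin> C'\<close> by auto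
  have "card {x, y, z} \<le> card ?F" using d assms finite_quad_union by (intro card_mono) auto
  then have "card (?F - {x} - {y} - {z}) + 3 = card ?F"
    using d assms finite_quad_union by (simp add: card_Diff_singleton_if)
  moreover have "rk M (?F - {x} - {y} - {z}) \<le> card (?F - {x} - {y} - {z})"
    using finite_quad_union by (intro rk_le_card) auto
  ultimately show False using r1 r2 r3 rk_quad_union by linarith
qed

lemma quad_elems_neq:
  assumes "C \<in> q" "C' \<in> q" "C \<noteq> C'" "x \<in> \<Union>q - C" "y \<in> \<Union>q - C'"
  shows "x \<noteq> y"
  using quad_cover[of C C' x] assms by blast

lemma quad_avoiding_elem:
  assumes "C \<in> q" obtains x where "x \<in> \<Union>q" "x \<notin> C"
proof -
  have "q \<noteq> {C}" using q_card by auto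
  then obtain C' where "C' \<in> q" "C' \<noteq> C" using assms by auto
  then show ?thesis using that circuit_antichain[of C' C] q_circuits assms by blast
qed

text \<open>If \<open>Jab\<close>, \<open>Jac\<close>, \<dots>, \<open>Jcd\<close> are six bases and \<open>S = J \<union> {a, b, c, d}\<close>, then
  circuits of \<open>S - {a}\<close>, \<dots>, \<open>S - {d}\<close> form a quadruple with hull \<open>S\<close>. The bases are written
  as complements of pairs, so that \<open>Jab\<close> is \<open>S - {c, d}\<close>.\<close>

definition hull :: "'a set \<Rightarrow> bool" where
  "hull S \<longleftrightarrow> S \<subseteq> ground M \<and> \<Union>q \<subseteq> S \<and> card S = rk M (ground M) + 2 \<and> rk M S = rk M (ground M)"

text \<open>Deleting \<open>x\<close> keeps the rank because of \<open>C'\<close>, and deleting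
  \<open>y\<close> afterwards keeps it because of \<open>C\<close>, which avoids \<open>x\<close>.
  The size is then right for a basis.\<close>

lemma hull_basis:
  assumes "hull S" "C \<in> q" "C' \<in> q" "C \<noteq> C'" "x \<in> \<Union>q - C" "y \<in> \<Union>q - C'"
  shows "S - {x, y} \<in> bases M"
proof -
  have S: "\<Union>q \<subseteq> S" "card S = rk M (ground M) + 2" "rk M S = rk M (ground M)" "finite S"
    using assms(1) finite_ground finite_subset unfolding hull_def by blast+
  have xy: "x \<in> C'" "y \<in> C" using quad_cover assms by (metis DiffD1 DiffD2)+
  have circ: "C \<in> circuits M" "C' \<in> circuits M" using assms q_circuits by auto
  have "rk M (S - {x}) = rk M S"
    using xy circ assms(3) S by (intro rk_diff_circuit_elem[of C']) auto
  moreover have "rk M (S - {x} - {y}) = rk M (S - {x})"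
    using xy circ assms S by (intro rk_diff_circuit_elem[of C]) auto
  moreover have "S - {x, y} = S - {x} - {y}" by auto
  moreover have "card (S - {x, y}) = rk M (ground M)"
  proof -
    have "x \<noteq> y" "{x, y} \<subseteq> S" using xy assms S by auto
    then show ?thesis using S by (simp add: card_Diff_subset)
  qed
  ultimately show ?thesis using S by (intro basisI_rk) auto
qed

lemma hull_not_basis:
  assumes "hull S" "C \<in> q" "x \<notin> C" "y \<notin> C"
  shows "S - {x, y} \<notin> bases M"
  using assms circuit_not_subset_basis[of C] q_circuits unfolding hull_def by blast

lemma hull_insert_basis:
  assumes "B \<in> bases M" "a \<in> ground M" "b \<in> ground M" "a \<notin> B" "b \<notin> B" "a \<noteq> b"
    "\<Union>q \<subseteq> insert a (insert b B)"
  shows "hull (insert a (insert b B))"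
proof -
  let ?S = "insert a (insert b B)"
  have "?S \<subseteq> ground M" using assms basis_subset_ground by auto
  then have "rk M ?S \<le> rk M (ground M)" by (rule rk_mono)
  moreover have "rk M (ground M) \<le> rk M ?S"
    using card_le_rk[of B ?S] assms bases_iff by auto
  ultimately show ?thesis
    using assms \<open>?S \<subseteq> ground M\<close> finite_basis[of B] card_basis by (auto simp: hull_def)
qed

text \<open>Without one element avoided by \<open>C\<close> and one avoided by \<open>C'\<close>,
  the union of \<open>q\<close> is independent. Extend it to a basis and put the two elements back;
  neither is in the basis, which would otherwise contain a circuit.\<close>

lemma hull_exists: obtains S where "hull S"
proof -
  obtain C where C: "C \<in> q" using q_card by fastforce
  then have "q \<noteq> {C}" using q_card by auto
  then obtain C' where C': "C' \<in> q" "C' \<noteq> C" using C by auto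
  let ?F = "\<Union>q"
  obtain x where x: "x \<in> ?F" "x \<notin> C" using quad_avoiding_elem C by blast
  obtain y where y: "y \<in> ?F" "y \<notin> C'" using quad_avoiding_elem C' by blast
  have xy: "x \<in> C'" "y \<in> C" using quad_cover C C' x y by metis+
  have circ: "C \<in> circuits M" "C' \<in> circuits M" using C C' q_circuits by auto
  have "rk M (?F - {x}) = rk M ?F"
    using xy circ C' by (intro rk_diff_circuit_elem[of C']) auto
  moreover have "rk M (?F - {x} - {y}) = rk M (?F - {x})"
    using xy circ x C by (intro rk_diff_circuit_elem[of C]) auto
  moreover have "?F - {x, y} = ?F - {x} - {y}" by auto
  moreover have "card (?F - {x, y}) = card ?F - 2"
  proof -
    have "x \<noteq> y" "{x, y} \<subseteq> ?F" using xy x y by auto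
    then show ?thesis by (simp add: card_Diff_subset)
  qed
  ultimately have r: "rk M (?F - {x, y}) = card (?F - {x, y})" using rk_quad_union by simp
  obtain I where "I \<in> indep M" "I \<subseteq> ?F - {x, y}" "card I = rk M (?F - {x, y})"
    by (rule rk_witness)
  then have i: "?F - {x, y} \<in> indep M"
    using r finite_quad_union card_subset_eq by (metis finite_Diff)
  obtain K where K: "K \<in> indep M" "card K = rk M (ground M)" by (metis rk_witness)
  have "card (?F - {x, y}) \<le> card K"
    using K card_le_rk[OF i] quad_union_ground by auto
  then obtain B where B: "B \<in> indep M" "?F - {x, y} \<subseteq> B" "card B = card K"
    using indep_extend[OF i K(1)] by metis
  have bB: "B \<in> bases M" using B K bases_iff by auto
  have nx: "x \<notin> B"
  proof
    assume "x \<in> B"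
    then have "C' \<subseteq> B" using B y C' by auto
    then show False using circuit_not_subset_basis circ bB by blast
  qed
  have ny: "y \<notin> B"
  proof
    assume "y \<in> B"
    then have "C \<subseteq> B" using B x C by auto
    then show False using circuit_not_subset_basis circ bB by blast
  qed
  have "hull (insert x (insert y B))"
    using bB nx ny xy x y quad_union_ground B(2) by (intro hull_insert_basis) auto
  then show ?thesis by (rule that)
qed

end

text \<open>\<open>S - {x}\<close> has one element more than a basis, so it contains a circuit
  \<open>c x\<close>. The six bases force these circuits to be distinct and their union to have
  nullity exactly two.\<close>

lemma (in matroid) circuit_quad_of_bases:
  assumes "S \<subseteq> ground M" "card S = rk M (ground M) + 2"
    and T: "T \<subseteq> S" "card T = 4"
    and bases: "\<forall>x\<in>T. \<forall>y\<in>T. x \<noteq> y \<longrightarrow> S - {x, y} \<in> bases M"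
  obtains c where "inj_on c T" "circuit_quad M (c ` T)" "circuit_quad.hull M (c ` T) S"
    "\<forall>x\<in>T. x \<in> \<Union>(c ` T) - c x"
proof -
  have finT: "finite T" using T by (metis card.infinite zero_neq_numeral)
  have finS: "finite S" using assms(1) finite_ground finite_subset by blast
  have "\<exists>C. C \<in> circuits M \<and> C \<subseteq> S - {x}" if "x \<in> T" for x
  proof -
    have "card (S - {x}) = rk M (ground M) + 1" using that T assms finS by auto
    then have "S - {x} \<notin> indep M"
      using card_le_rk[of "S - {x}" "ground M"] assms(1) by auto
    moreover have "S - {x} \<subseteq> ground M" using assms(1) by auto
    ultimately show ?thesis by (metis dependent_circuit)
  qed
  then obtain c where c: "\<And>x. x \<in> T \<Longrightarrow> c x \<in> circuits M" "\<And>x. x \<in> T \<Longrightarrow> c x \<subseteq> S - {x}"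
    by metis
  \<comment> \<open>A circuit that missed a second element \<open>y\<close> of \<open>T\<close>
    would lie in the basis \<open>S - {x, y}\<close>.\<close>
  have mem: "y \<in> c x" if "x \<in> T" "y \<in> T" "x \<noteq> y" for x y
  proof (rule ccontr)
    assume "y \<notin> c x"
    then have "c x \<subseteq> S - {x, y}" using c that by auto
    then show False using circuit_not_subset_basis c that bases by metis
  qed
  have inj: "inj_on c T" using mem c by (intro inj_onI) blast
  have el: "x \<in> \<Union>(c ` T) - c x" if "x \<in> T" for x
  proof -
    have "T \<noteq> {x}" using T by auto
    with \<open>x \<in> T\<close> obtain y where "y \<in> T" "y \<noteq> x" by blast
    then show ?thesis using mem[of y x] c(2)[of x] that by auto
  qed
  obtain a where a: "a \<in> T" using T by fastforce
  have "T \<noteq> {a}" using T by auto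
  then obtain b where b: "b \<in> T" "b \<noteq> a" using a by auto
  let ?F = "\<Union>(c ` T)"
  have FS: "?F \<subseteq> S" using c by auto
  have finF: "finite ?F" using FS finS finite_subset by blast
  have "rk M (?F - {a}) = rk M ?F"
    using a b c mem[of b a] by (intro rk_diff_circuit_elem[of "c b"]) auto
  moreover have "rk M (?F - {a} - {b}) = rk M (?F - {a})"
    using a b c mem[of a b] by (intro rk_diff_circuit_elem[of "c a"]) auto
  moreover have "rk M (?F - {a} - {b}) = card (?F - {a} - {b})"
  proof (rule antisym)
    show "rk M (?F - {a} - {b}) \<le> card (?F - {a} - {b})" using finF by (intro rk_le_card) auto
    have "S - {a, b} \<in> indep M" using bases a b bases_iff by metis
    moreover have "?F - {a} - {b} \<subseteq> S - {a, b}" using FS by auto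
    ultimately have "?F - {a} - {b} \<in> indep M" by (rule indep_mono)
    then show "card (?F - {a} - {b}) \<le> rk M (?F - {a} - {b})" by (rule card_le_rk) auto
  qed
  moreover have "card (?F - {a} - {b}) + 2 = card ?F"
  proof -
    have "{a, b} \<subseteq> ?F" "a \<noteq> b" using el a b by auto
    moreover from this have "card {a, b} \<le> card ?F" using finF by (intro card_mono) auto
    moreover have "?F - {a} - {b} = ?F - {a, b}" by auto
    ultimately show ?thesis using finF by (simp add: card_Diff_subset)
  qed
  ultimately have "union_dim M ?F = 1" unfolding union_dim_def by linarith
  then interpret Q: circuit_quad M "c ` T"
    using c T inj by unfold_locales (auto simp: card_image)
  have "Q.hull (insert a (insert b (S - {a, b})))"
    using a b T bases assms(1) FS by (intro Q.hull_insert_basis) auto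
  moreover have "insert a (insert b (S - {a, b})) = S" using a b T by auto
  ultimately show ?thesis using that[OF inj Q.circuit_quad_axioms] el by simp
qed

section \<open>Functions on bases\<close>

lemma successively_splitD:
  assumes "successively P (xs @ v # ys)"
  shows "successively P (xs @ [v])" "successively P (v # ys)"
  using assms by (auto simp: successively_append_iff)

lemma successively_glue:
  assumes "successively P (xs @ [v])" "successively P (v # ys)"
  shows "successively P (xs @ v # ys)"
  using assms by (auto simp: successively_append_iff)

section \<open>Fractions in a commutative group\<close>

context comm_group
begin

lemma frac_eq_iff:
  assumes "a \<in> carrier G" "b \<in> carrier G" "c \<in> carrier G" "d \<in> carrier G"
  shows "a \<otimes> inv b = c \<otimes> inv d \<longleftrightarrow> a \<otimes> d = c \<otimes> b"
proof -
  have "inv b \<otimes> (b \<otimes> d) = d" "inv d \<otimes> (d \<otimes> b) = b"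
    using assms by (simp_all add: m_assoc[symmetric])
  then have "(a \<otimes> inv b) \<otimes> (b \<otimes> d) = a \<otimes> d" "(c \<otimes> inv d) \<otimes> (b \<otimes> d) = c \<otimes> b"
    using assms by (simp_all add: m_assoc m_comm[of b d])
  moreover have "a \<otimes> inv b = c \<otimes> inv d \<longleftrightarrow>
      (a \<otimes> inv b) \<otimes> (b \<otimes> d) = (c \<otimes> inv d) \<otimes> (b \<otimes> d)"
    using assms by (intro right_cancel[symmetric]) auto
  ultimately show ?thesis by simp
qed

lemma frac_mult:
  assumes "a \<in> carrier G" "b \<in> carrier G" "c \<in> carrier G" "d \<in> carrier G"
  shows "(a \<otimes> inv b) \<otimes> (c \<otimes> inv d) = (a \<otimes> c) \<otimes> inv (b \<otimes> d)"
  using assms by (simp add: inv_mult m_ac)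

lemma frac_one_iff:
  assumes "a \<in> carrier G" "b \<in> carrier G"
  shows "a \<otimes> inv b = \<one> \<longleftrightarrow> a = b"
  using frac_eq_iff[of a b \<one> \<one>] assms by simp

lemma frac_inverse:
  assumes "a \<in> carrier G" "b \<in> carrier G"
  shows "(a \<otimes> inv b) \<otimes> (b \<otimes> inv a) = \<one>"
  using assms by (simp add: frac_mult frac_one_iff m_comm del: inv_mult_group inv_mult)

end

locale basis_function = matroid M + comm_group G
  for M :: "'a indep_system" and G :: "('g, 'm) monoid_scheme" (structure) +
  fixes \<psi> :: "'a set \<Rightarrow> 'g"
  assumes value_closed [simp, intro]: "B \<in> bases M \<Longrightarrow> \<psi> B \<in> carrier G"

locale balanced_basis_function = basis_function M G \<psi>
  for M :: "'a indep_system" and G :: "('g, 'm) monoid_scheme" (structure) and \<psi> +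
  assumes balanced: "\<lbrakk>distinct [a, b, c, d]; {a, b, c, d} \<subseteq> S;
      S - {a, b} \<in> bases M; S - {c, d} \<in> bases M; S - {a, c} \<in> bases M; S - {b, d} \<in> bases M\<rbrakk> \<Longrightarrow>
      \<psi> (S - {a, b}) \<otimes> \<psi> (S - {c, d}) = \<psi> (S - {a, c}) \<otimes> \<psi> (S - {b, d})"
begin

text \<open>In \<open>B\<close> with \<open>e\<close> and \<open>e'\<close> added, the six
  complements of pairs from these four elements form three pairings. The two compared here are those
  that do not involve \<open>B\<close>.\<close>

lemma four_cycle:
  assumes "b \<in> B" "b' \<in> B" "e \<notin> B" "e' \<notin> B"
    "insert e (B - {b}) \<in> bases M" "insert e' (B - {b'}) \<in> bases M"
    "insert e' (B - {b}) \<in> bases M" "insert e (B - {b'}) \<in> bases M"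
  shows "\<psi> (insert e (B - {b})) \<otimes> \<psi> (insert e' (B - {b'})) =
    \<psi> (insert e' (B - {b})) \<otimes> \<psi> (insert e (B - {b'}))"
proof (cases "b = b' \<or> e = e'")
  case True
  then show ?thesis using assms by (auto simp: m_comm)
next
  case False
  let ?S = "insert e (insert e' B)"
  have eq: "insert e (B - {b}) = ?S - {b, e'}" "insert e' (B - {b'}) = ?S - {e, b'}"
    "insert e' (B - {b}) = ?S - {b, e}" "insert e (B - {b'}) = ?S - {e', b'}"
    using False assms by auto
  show ?thesis using assms False unfolding eq by (intro balanced) auto
qed

section \<open>Double exchanges, as in 2 by 2 minors\<close>

context
  fixes B b b' e e'
  assumes B: "B \<in> bases M" "b \<in> B" "b' \<in> B" "b \<noteq> b'" "e \<notin> B" "e' \<notin> B" "e \<noteq> e'"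
begin

text \<open>The same six sets are written as complements of pairs, the form used by
  \<open>balanced\<close>, and in \<open>pivot_J_eqs\<close> as pairs added to a common part, the
  form used by \<open>basis_pair_exchange\<close>.\<close>

lemma pivot_set_eqs:
  shows "B = insert e (insert e' B) - {e, e'}"
    "insert e (insert e' (B - {b'}) - {b}) = insert e (insert e' B) - {b, b'}"
    "insert e' (B - {b}) = insert e (insert e' B) - {e, b}"
    "insert e (B - {b'}) = insert e (insert e' B) - {e', b'}"
    "insert e (B - {b}) = insert e (insert e' B) - {e', b}"
    "insert e' (B - {b'}) = insert e (insert e' B) - {e, b'}"
  using B by auto

lemma pivot_J_eqs:
  shows "B = insert b (insert b' (B - {b, b'}))"
    "insert e (insert e' (B - {b'}) - {b}) = insert e (insert e' (B - {b, b'}))"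
    "insert e' (B - {b}) = insert e' (insert b' (B - {b, b'}))"
    "insert e (B - {b'}) = insert e (insert b (B - {b, b'}))"
    "insert e (B - {b}) = insert e (insert b' (B - {b, b'}))"
    "insert e' (B - {b'}) = insert e' (insert b (B - {b, b'}))"
  using B by auto

lemma pivot_value_cross:
  assumes "insert e' (B - {b}) \<in> bases M" "insert e (B - {b'}) \<in> bases M"
    "insert e (insert e' (B - {b'}) - {b}) \<in> bases M"
  shows "\<psi> B \<otimes> \<psi> (insert e (insert e' (B - {b'}) - {b})) =
    \<psi> (insert e' (B - {b})) \<otimes> \<psi> (insert e (B - {b'}))"
proof -
  let ?S = "insert e (insert e' B)"
  have "\<psi> (?S - {e, e'}) \<otimes> \<psi> (?S - {b, b'}) = \<psi> (?S - {e, b}) \<otimes> \<psi> (?S - {e', b'})"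
    using B assms pivot_set_eqs by (intro balanced) auto
  then show ?thesis using pivot_set_eqs by simp
qed

lemma pivot_value_parallel:
  assumes "insert e (B - {b}) \<in> bases M" "insert e' (B - {b'}) \<in> bases M"
    "insert e (insert e' (B - {b'}) - {b}) \<in> bases M"
  shows "\<psi> B \<otimes> \<psi> (insert e (insert e' (B - {b'}) - {b})) =
    \<psi> (insert e (B - {b})) \<otimes> \<psi> (insert e' (B - {b'}))"
proof -
  let ?S = "insert e (insert e' B)"
  have "\<psi> (?S - {e', e}) \<otimes> \<psi> (?S - {b, b'}) = \<psi> (?S - {e', b}) \<otimes> \<psi> (?S - {e, b'})"
    using B assms pivot_set_eqs by (intro balanced) (auto simp: insert_commute)
  then show ?thesis using pivot_set_eqs by (simp add: insert_commute)
qed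

text \<open>Picture the 2 by 2 matrix with rows \<open>b\<close>, \<open>b'\<close> and columns
  \<open>e\<close>, \<open>e'\<close> whose nonzero entries mark bases. With a zero on the diagonal
  and both other entries nonzero, its determinant, which stands for the double exchange, cannot
  cancel. \<open>pivot_basis_parallel\<close> is the same with the diagonals interchanged.\<close>

lemma pivot_basis_cross:
  assumes "insert e' (B - {b}) \<in> bases M" "insert e (B - {b'}) \<in> bases M"
    "insert e (B - {b}) \<notin> bases M"
  shows "insert e (insert e' (B - {b'}) - {b}) \<in> bases M"
proof -
  have "insert b' (insert e' (B - {b, b'})) \<in> bases M" "insert e (insert b (B - {b, b'})) \<in> bases M"
    "insert e (insert b' (B - {b, b'})) \<notin> bases M"
    using assms unfolding pivot_J_eqs(3,4,5) by (simp_all add: insert_commute)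
  then show ?thesis
    unfolding pivot_J_eqs(2) using B by (rule_tac basis_pair_exchange) auto
qed

lemma pivot_basis_parallel:
  assumes "insert e (B - {b}) \<in> bases M" "insert e' (B - {b'}) \<in> bases M"
    "insert e' (B - {b}) \<notin> bases M \<or> insert e (B - {b'}) \<notin> bases M"
  shows "insert e (insert e' (B - {b'}) - {b}) \<in> bases M"
proof -
  let ?J = "B - {b, b'}"
  have 1: "insert b' (insert e ?J) \<in> bases M" "insert e' (insert b ?J) \<in> bases M"
    using assms unfolding pivot_J_eqs(5,6) by (simp_all add: insert_commute)
  have "insert e' (insert b' ?J) \<notin> bases M \<or> insert e (insert b ?J) \<notin> bases M"
    using assms(3) unfolding pivot_J_eqs(3,4) .
  then show ?thesis
  proof
    assume "insert e' (insert b' ?J) \<notin> bases M"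
    with 1 have "insert e' (insert e ?J) \<in> bases M"
      using B by (rule_tac basis_pair_exchange) auto
    then show ?thesis unfolding pivot_J_eqs(2) by (simp add: insert_commute)
  next
    assume "insert e (insert b ?J) \<notin> bases M"
    then show ?thesis
      using 1 B unfolding pivot_J_eqs(2)
      by (intro basis_pair_exchange[of b e' _ e b']) (auto simp: insert_commute)
  qed
qed

text \<open>A nonzero 2 by 2 determinant has a nonzero diagonal or antidiagonal product; otherwise a
  row or column vanishes, which \<open>basis_pair_exchange\<close> excludes. Thus one of the two
  value formulas for the double exchange always applies.\<close>

lemma pivot_basis_cases:
  assumes "insert e (insert e' (B - {b'}) - {b}) \<in> bases M" "insert e' (B - {b'}) \<in> bases M"
  shows "insert e' (B - {b}) \<in> bases M \<and> insert e (B - {b'}) \<in> bases M \<or> insert e (B - {b}) \<in> bases M"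
proof (rule ccontr)
  assume neg: "\<not> ?thesis"
  have bb: "insert b (insert b' (B - {b, b'})) \<in> bases M"
    and N: "insert e (insert e' (B - {b, b'})) \<in> bases M"
    using B(1) assms(1) pivot_J_eqs(1,2) by simp_all
  from neg consider "insert e' (B - {b}) \<notin> bases M" "insert e (B - {b}) \<notin> bases M"
    | "insert e (B - {b'}) \<notin> bases M" "insert e (B - {b}) \<notin> bases M" by blast
  then show False
  proof cases
    case 1
    then have "insert e' (insert b' (B - {b, b'})) \<notin> bases M" "insert e (insert b' (B - {b, b'})) \<notin> bases M"
      unfolding pivot_J_eqs(3,5) by auto
    then show False
      using basis_pair_exchange[of e' e "B - {b, b'}" b' b] N bb B by (auto simp: insert_commute)
  next
    case 2
    then have "insert e (insert b (B - {b, b'})) \<notin> bases M" "insert e (insert b' (B - {b, b'})) \<notin> bases M"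
      unfolding pivot_J_eqs(4,5) by auto
    then show False
      using basis_pair_exchange[of b b' "B - {b, b'}" e e'] N bb B by (auto simp: insert_commute)
  qed
qed

end

subsection \<open>Closed walks in fundamental graphs\<close>

definition adj :: "'a set \<Rightarrow> 'a \<Rightarrow> 'a \<Rightarrow> bool" where
  "adj B u v \<longleftrightarrow> u \<in> B \<and> v \<notin> B \<and> insert v (B - {u}) \<in> bases M \<or>
    v \<in> B \<and> u \<notin> B \<and> insert u (B - {v}) \<in> bases M"

text \<open>The second case is the inverse of the first, so an edge run in both directions
  contributes \<one> to a walk.\<close>

definition edge_weight :: "'a set \<Rightarrow> 'a \<Rightarrow> 'a \<Rightarrow> 'g" where
  "edge_weight B u v = (if u \<in> B then \<psi> (insert v (B - {u})) \<otimes> inv \<psi> B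
    else \<psi> B \<otimes> inv \<psi> (insert u (B - {v})))"

lemma adj_sym: "adj B u v \<longleftrightarrow> adj B v u"
  unfolding adj_def by auto

lemma adj_sides: "adj B u v \<Longrightarrow> u \<in> B \<longleftrightarrow> v \<notin> B"
  unfolding adj_def by auto

lemma adj_neq: "adj B u v \<Longrightarrow> u \<noteq> v"
  unfolding adj_def by auto

lemma adj_iff: "b \<in> B \<Longrightarrow> e \<notin> B \<Longrightarrow> adj B b e \<longleftrightarrow> insert e (B - {b}) \<in> bases M"
  "b \<in> B \<Longrightarrow> e \<notin> B \<Longrightarrow> adj B e b \<longleftrightarrow> insert e (B - {b}) \<in> bases M"
  unfolding adj_def by auto

lemma edge_weight_closed [simp, intro]:
  "B \<in> bases M \<Longrightarrow> adj B u v \<Longrightarrow> edge_weight B u v \<in> carrier G"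
  unfolding edge_weight_def adj_def by auto

lemma edge_weight_inverse:
  assumes "B \<in> bases M" "adj B u v"
  shows "edge_weight B u v \<otimes> edge_weight B v u = \<one>"
  using assms by (auto simp: edge_weight_def adj_def frac_inverse)

definition pivot :: "'a set \<Rightarrow> 'a \<Rightarrow> 'a \<Rightarrow> 'a set" where
  "pivot B p q = (if p \<in> B then insert q (B - {p}) else insert p (B - {q}))"

lemma pivot_sym: "adj B p q \<Longrightarrow> pivot B p q = pivot B q p"
  unfolding pivot_def adj_def by auto

lemma pivot_basis: "adj B p q \<Longrightarrow> pivot B p q \<in> bases M"
  unfolding pivot_def adj_def by auto

text \<open>By \<open>pivot_value_parallel\<close>, the quotient of the values after and before
  exchanging \<open>b\<close> for \<open>e\<close> is the same at the pivoted basis as at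
  \<open>B\<close>. A missing cross edge ensures that the double exchange is a basis.\<close>

lemma pivot_parallel_aux:
  assumes "B \<in> bases M" "b \<in> B" "e \<notin> B" "adj B b e" "b' \<in> B" "e' \<notin> B" "adj B b' e'"
    "b \<noteq> b'" "e \<noteq> e'" "\<not> (adj B b e' \<and> adj B e b')"
  shows "adj (pivot B b' e') b e" "edge_weight (pivot B b' e') b e = edge_weight B b e"
    "edge_weight (pivot B b' e') e b = edge_weight B e b"
proof -
  let ?P = "insert e' (B - {b'})"
  have P: "pivot B b' e' = ?P" using assms by (simp add: pivot_def)
  have bs: "insert e (B - {b}) \<in> bases M" "?P \<in> bases M"
    "insert e' (B - {b}) \<notin> bases M \<or> insert e (B - {b'}) \<notin> bases M"
    using assms by (auto simp: adj_iff)
  have N: "insert e (?P - {b}) \<in> bases M"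
    using assms bs by (intro pivot_basis_parallel) auto
  have mem: "b \<in> ?P" "e \<notin> ?P" using assms by auto
  show "adj (pivot B b' e') b e" unfolding P using mem N by (simp add: adj_iff)
  have v: "\<psi> B \<otimes> \<psi> (insert e (?P - {b})) = \<psi> (insert e (B - {b})) \<otimes> \<psi> ?P"
    using assms bs N by (intro pivot_value_parallel) auto
  have v': "\<psi> (insert e (?P - {b})) \<otimes> \<psi> B = \<psi> (insert e (B - {b})) \<otimes> \<psi> ?P"
    "\<psi> ?P \<otimes> \<psi> (insert e (B - {b})) = \<psi> B \<otimes> \<psi> (insert e (?P - {b}))"
    unfolding v using assms bs N by (simp_all add: v[symmetric] m_comm)
  show "edge_weight (pivot B b' e') b e = edge_weight B b e"
    "edge_weight (pivot B b' e') e b = edge_weight B e b"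
    unfolding P edge_weight_def using assms bs N v' mem by (simp_all add: frac_eq_iff)
qed

text \<open>Which of the two excluded four-cycles could occur depends on whether \<open>x\<close>
  and \<open>p\<close> are on the same side of \<open>B\<close>; assuming both away makes the
  statement independent of sides.\<close>

lemma pivot_parallel:
  assumes "B \<in> bases M" "adj B x y" "adj B p q" "{x, y} \<inter> {p, q} = {}"
    "\<not> (adj B x p \<and> adj B y q)" "\<not> (adj B x q \<and> adj B y p)"
  shows "adj (pivot B p q) x y \<and> edge_weight (pivot B p q) x y = edge_weight B x y"
proof -
  have *: "adj (pivot B p q) x y \<and> edge_weight (pivot B p q) x y = edge_weight B x y"
    if "p \<in> B" "adj B p q" "{x, y} \<inter> {p, q} = {}"
      "\<not> (adj B x p \<and> adj B y q)" "\<not> (adj B x q \<and> adj B y p)" for p q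
  proof (cases "x \<in> B")
    case True
    then show ?thesis
      using pivot_parallel_aux[of B x y p q] assms(1,2) that adj_sides adj_sym by blast
  next
    case False
    then show ?thesis
      using pivot_parallel_aux[of B y x p q] assms(1,2) that adj_sides adj_sym by blast
  qed
  show ?thesis
  proof (cases "p \<in> B")
    case True
    then show ?thesis using * assms by blast
  next
    case False
    then have "q \<in> B" using assms adj_sides by blast
    then show ?thesis using *[of q p] assms adj_sym pivot_sym by (metis insert_commute)
  qed
qed

text \<open>Here \<open>pivot_value_cross\<close> applies: dividing it by the values at
  \<open>B\<close> and at the pivoted basis yields the weight of the path from \<open>b\<close> over
  \<open>e'\<close> and \<open>b'\<close> to \<open>e\<close>. Both directions are recorded because
  the walk may enter the path at either end.\<close>

lemma pivot_cross_aux: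
  assumes "B \<in> bases M" "b \<in> B" "e' \<notin> B" "b' \<in> B" "e \<notin> B"
    "adj B b e'" "adj B b' e'" "adj B b' e" "\<not> adj B b e"
  shows "adj (pivot B b' e') b e"
    "edge_weight (pivot B b' e') b e =
      edge_weight B b e' \<otimes> (edge_weight B e' b' \<otimes> edge_weight B b' e)"
    "edge_weight (pivot B b' e') e b =
      edge_weight B e b' \<otimes> (edge_weight B b' e' \<otimes> edge_weight B e' b)"
proof -
  let ?P = "insert e' (B - {b'})"
  have P: "pivot B b' e' = ?P" using assms by (simp add: pivot_def)
  have ne: "b \<noteq> b'" "e \<noteq> e'" using assms by auto
  have bs: "insert e' (B - {b}) \<in> bases M" "?P \<in> bases M" "insert e (B - {b'}) \<in> bases M"
    "insert e (B - {b}) \<notin> bases M"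
    using assms by (auto simp: adj_iff)
  have N: "insert e (?P - {b}) \<in> bases M"
    using assms bs ne by (intro pivot_basis_cross) auto
  have mem: "b \<in> ?P" "e \<notin> ?P" using assms ne by auto
  show "adj (pivot B b' e') b e" unfolding P using mem N by (simp add: adj_iff)
  have v: "\<psi> B \<otimes> \<psi> (insert e (?P - {b})) = \<psi> (insert e' (B - {b})) \<otimes> \<psi> (insert e (B - {b'}))"
    using assms bs N ne by (intro pivot_value_cross) auto
  show "edge_weight (pivot B b' e') b e =
      edge_weight B b e' \<otimes> (edge_weight B e' b' \<otimes> edge_weight B b' e)"
  proof -
    \<comment> \<open>This is the goal with denominators cleared, as \<open>frac_mult\<close> and
      \<open>frac_eq_iff\<close> will present it.\<close>
    have "\<psi> (insert e (?P - {b})) \<otimes> (\<psi> B \<otimes> (\<psi> ?P \<otimes> \<psi> B)) =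
        (\<psi> B \<otimes> \<psi> (insert e (?P - {b}))) \<otimes> (\<psi> ?P \<otimes> \<psi> B)"
      using assms bs N by (simp add: m_ac)
    also have "\<dots> = \<psi> (insert e' (B - {b})) \<otimes> (\<psi> B \<otimes> \<psi> (insert e (B - {b'}))) \<otimes> \<psi> ?P"
      unfolding v using assms bs N by (simp add: m_ac)
    finally show ?thesis
      unfolding P edge_weight_def using assms bs N mem
      by (simp add: frac_eq_iff frac_mult)
  qed
  show "edge_weight (pivot B b' e') e b =
      edge_weight B e b' \<otimes> (edge_weight B b' e' \<otimes> edge_weight B e' b)"
  proof -
    have "\<psi> B \<otimes> (\<psi> ?P \<otimes> \<psi> B) \<otimes> \<psi> (insert e (?P - {b})) =
        (\<psi> B \<otimes> \<psi> (insert e (?P - {b}))) \<otimes> (\<psi> ?P \<otimes> \<psi> B)"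
      using assms bs N by (simp add: m_ac)
    also have "\<dots> = \<psi> ?P \<otimes> (\<psi> (insert e (B - {b'})) \<otimes> (\<psi> B \<otimes> \<psi> (insert e' (B - {b}))))"
      unfolding v using assms bs N by (simp add: m_ac)
    finally show ?thesis
      unfolding P edge_weight_def using assms bs N mem
      by (simp add: frac_eq_iff frac_mult)
  qed
qed

lemma pivot_cross:
  assumes "B \<in> bases M" "adj B u p" "adj B p q" "adj B q v" "\<not> adj B u v"
  shows "adj (pivot B p q) u v"
    "edge_weight (pivot B p q) u v = edge_weight B u p \<otimes> (edge_weight B p q \<otimes> edge_weight B q v)"
proof -
  have "adj (pivot B p q) u v \<and>
    edge_weight (pivot B p q) u v = edge_weight B u p \<otimes> (edge_weight B p q \<otimes> edge_weight B q v)"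
  proof (cases "u \<in> B")
    case True
    then have "p \<notin> B" "q \<in> B" "v \<notin> B" using adj_sides assms by blast+
    then show ?thesis
      using pivot_cross_aux(1,2)[of B u p q v] assms True adj_sym pivot_sym by metis
  next
    case False
    then have "p \<in> B" "q \<notin> B" "v \<in> B" using adj_sides assms by blast+
    then show ?thesis
      using pivot_cross_aux(1,3)[of B v q p u] assms False adj_sym by metis
  qed
  then show "adj (pivot B p q) u v"
    "edge_weight (pivot B p q) u v = edge_weight B u p \<otimes> (edge_weight B p q \<otimes> edge_weight B q v)"
    by auto
qed

section \<open>Weights of walks\<close>

fun walk_weight :: "'a set \<Rightarrow> 'a list \<Rightarrow> 'g" where
  "walk_weight B (x # y # zs) = edge_weight B x y \<otimes> walk_weight B (y # zs)"
| "walk_weight B _ = \<one>"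

lemma walk_weight_closed [simp, intro]:
  "B \<in> bases M \<Longrightarrow> successively (adj B) xs \<Longrightarrow> walk_weight B xs \<in> carrier G"
  by (induction B xs rule: walk_weight.induct) auto

lemma walk_weight_append:
  assumes "B \<in> bases M" "successively (adj B) (xs @ v # ys)"
  shows "walk_weight B (xs @ v # ys) = walk_weight B (xs @ [v]) \<otimes> walk_weight B (v # ys)"
  using assms
proof (induction xs rule: induct_list012)
  case 1
  then show ?case by auto
next
  case (2 x)
  then show ?case by (auto simp: successively_Cons)
next
  case (3 x y zs)
  have s: "adj B x y" "successively (adj B) (y # zs @ v # ys)" using 3 by auto
  then have "successively (adj B) (v # ys)" "successively (adj B) (y # zs @ [v])"
    using successively_append_iff[of "adj B" "y # zs" "v # ys"]
      successively_append_iff[of "adj B" "y # zs" "[v]"] by auto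
  then show ?case using 3 s by (auto simp: m_assoc)
qed

lemma walk_weight_rev:
  assumes "B \<in> bases M" "successively (adj B) xs"
  shows "successively (adj B) (rev xs) \<and> walk_weight B (rev xs) \<otimes> walk_weight B xs = \<one>"
  using assms
proof (induction xs rule: induct_list012)
  case (3 x y zs)
  have s: "adj B x y" "successively (adj B) (y # zs)" using 3 by auto
  have IH: "successively (adj B) (rev zs @ [y])"
    "walk_weight B (rev zs @ [y]) \<otimes> walk_weight B (y # zs) = \<one>"
    using 3 s by auto
  have yx: "adj B y x" using s adj_sym by blast
  have r: "successively (adj B) (rev zs @ y # [x])"
    using IH(1) yx by (rule_tac successively_glue) auto
  have c: "walk_weight B (rev zs @ [y]) \<in> carrier G" "walk_weight B (y # zs) \<in> carrier G"
    "edge_weight B x y \<in> carrier G" "edge_weight B y x \<in> carrier G"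
    using 3 IH s yx by auto
  have "walk_weight B (rev zs @ y # [x]) \<otimes> walk_weight B (x # y # zs) =
      walk_weight B (rev zs @ [y]) \<otimes> edge_weight B y x \<otimes> (edge_weight B x y \<otimes> walk_weight B (y # zs))"
    using walk_weight_append[OF 3(3) r] c by simp
  also have "\<dots> = (edge_weight B x y \<otimes> edge_weight B y x) \<otimes>
      (walk_weight B (rev zs @ [y]) \<otimes> walk_weight B (y # zs))"
    using c by (simp add: m_ac)
  also have "\<dots> = \<one>" using IH(2) edge_weight_inverse[OF 3(3) s(1)] by simp
  finally show ?case using r by simp
qed auto

end

context balanced_basis_function
begin

lemma adj_four_cycle:
  assumes "B \<in> bases M" "adj B s t" "adj B t u" "adj B u v" "adj B v s"
  shows "edge_weight B s t \<otimes> (edge_weight B t u \<otimes> (edge_weight B u v \<otimes> edge_weight B v s)) = \<one>"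
proof -
  have "s \<in> B \<and> t \<notin> B \<and> u \<in> B \<and> v \<notin> B \<or> s \<notin> B \<and> t \<in> B \<and> u \<notin> B \<and> v \<in> B"
    using adj_sides assms by blast
  then show ?thesis
  proof
    assume side: "s \<in> B \<and> t \<notin> B \<and> u \<in> B \<and> v \<notin> B"
    then have b: "insert t (B - {s}) \<in> bases M" "insert v (B - {u}) \<in> bases M"
      "insert v (B - {s}) \<in> bases M" "insert t (B - {u}) \<in> bases M"
      using assms by (auto simp: adj_iff)
    let ?b = "\<psi> B"
    have "\<psi> (insert t (B - {s})) \<otimes> (?b \<otimes> (\<psi> (insert v (B - {u})) \<otimes> ?b)) =
        (\<psi> (insert t (B - {s})) \<otimes> \<psi> (insert v (B - {u}))) \<otimes> (?b \<otimes> ?b)"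
      using b assms(1) by (simp add: m_ac)
    also have "\<dots> = (\<psi> (insert v (B - {s})) \<otimes> \<psi> (insert t (B - {u}))) \<otimes> (?b \<otimes> ?b)"
      using four_cycle[of s B u t v] side b by simp
    also have "\<dots> = ?b \<otimes> (\<psi> (insert t (B - {u})) \<otimes> (?b \<otimes> \<psi> (insert v (B - {s}))))"
      using b assms(1) by (simp add: m_ac)
    finally show ?thesis
      unfolding edge_weight_def using side b assms(1)
      by (simp add: frac_mult frac_one_iff del: inv_mult_group inv_mult)
  next
    assume side: "s \<notin> B \<and> t \<in> B \<and> u \<notin> B \<and> v \<in> B"
    then have b: "insert s (B - {t}) \<in> bases M" "insert u (B - {v}) \<in> bases M"
      "insert u (B - {t}) \<in> bases M" "insert s (B - {v}) \<in> bases M"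
      using assms by (auto simp: adj_iff)
    let ?b = "\<psi> B"
    have "?b \<otimes> (\<psi> (insert u (B - {t})) \<otimes> (?b \<otimes> \<psi> (insert s (B - {v})))) =
        (\<psi> (insert u (B - {t})) \<otimes> \<psi> (insert s (B - {v}))) \<otimes> (?b \<otimes> ?b)"
      using b assms(1) by (simp add: m_ac)
    also have "\<dots> = (\<psi> (insert s (B - {t})) \<otimes> \<psi> (insert u (B - {v}))) \<otimes> (?b \<otimes> ?b)"
      using four_cycle[of t B v u s] side b by simp
    also have "\<dots> = \<psi> (insert s (B - {t})) \<otimes> (?b \<otimes> (\<psi> (insert u (B - {v})) \<otimes> ?b))"
      using b assms(1) by (simp add: m_ac)
    finally show ?thesis
      unfolding edge_weight_def using side b assms(1)
      by (simp add: frac_mult frac_one_iff del: inv_mult_group inv_mult)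
  qed
qed

definition closed_walk :: "'a set \<Rightarrow> 'a list \<Rightarrow> bool" where
  "closed_walk B xs \<longleftrightarrow> successively (adj B) xs \<and> xs \<noteq> [] \<and> hd xs = last xs"

context
  fixes B n
  assumes B: "B \<in> bases M"
    and short: "\<And>ys. length ys < n \<Longrightarrow> closed_walk B ys \<Longrightarrow> walk_weight B ys = \<one>"
begin

text \<open>The detour from \<open>u\<close> back to \<open>u\<close> and the rest of the walk are
  both closed and shorter. The detour is shorter because something precedes or follows it.\<close>

lemma walk_weight_repeat:
  assumes "closed_walk B (xs @ u # ys @ u # zs)" "length (xs @ u # ys @ u # zs) = n" "xs \<noteq> [] \<or> zs \<noteq> []"
  shows "walk_weight B (xs @ u # ys @ u # zs) = \<one>"
proof -
  have s: "successively (adj B) (xs @ u # ys @ u # zs)" using assms by (simp add: closed_walk_def)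
  then have s1: "successively (adj B) (xs @ [u])" and s2: "successively (adj B) ((u # ys) @ u # zs)"
    using successively_splitD by fastforce+
  from s2 have s3: "successively (adj B) (u # ys @ [u])" and s4: "successively (adj B) (u # zs)"
    using successively_splitD by fastforce+
  have s5: "successively (adj B) (xs @ u # zs)" using s1 s4 by (rule successively_glue)
  have c1: "walk_weight B (u # ys @ [u]) = \<one>"
    using assms s3 by (intro short) (auto simp: closed_walk_def)
  have "hd (xs @ u # zs) = last (xs @ u # zs)"
    using assms by (cases xs) (auto simp: closed_walk_def)
  then have c2: "walk_weight B (xs @ u # zs) = \<one>"
    using assms s5 by (intro short) (auto simp: closed_walk_def)
  have "walk_weight B (xs @ u # ys @ u # zs) =
      walk_weight B (xs @ [u]) \<otimes> (walk_weight B (u # ys @ [u]) \<otimes> walk_weight B (u # zs))"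
    using walk_weight_append[OF B s] walk_weight_append[OF B s2] by simp
  also have "\<dots> = walk_weight B (xs @ u # zs)"
    using walk_weight_append[OF B s5] c1 B s4 by simp
  finally show ?thesis using c2 by simp
qed

text \<open>The chord splits the walk into two closed walks that run along it in opposite
  directions, so its weight cancels. The first two bounds make both pieces shorter:
  \<open>ys\<close> is replaced by the chord in one, and the other adds a single step back to
  \<open>u\<close> in place of \<open>xs\<close> and \<open>zs\<close>.\<close>

lemma walk_weight_chord:
  assumes "closed_walk B (xs @ u # ys @ v # zs)" "length (xs @ u # ys @ v # zs) = n"
    "ys \<noteq> []" "length xs + length zs > 1" "adj B u v"
  shows "walk_weight B (xs @ u # ys @ v # zs) = \<one>"
proof -
  have s: "successively (adj B) (xs @ u # ys @ v # zs)" using assms by (simp add: closed_walk_def)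
  then have s1: "successively (adj B) (xs @ [u])" and s2: "successively (adj B) ((u # ys) @ v # zs)"
    using successively_splitD by fastforce+
  from s2 have s3: "successively (adj B) (u # ys @ [v])" and s4: "successively (adj B) (v # zs)"
    using successively_splitD by fastforce+
  have vu: "adj B v u" using assms adj_sym by blast
  have s4': "successively (adj B) (u # v # zs)" using s4 assms by simp
  have s5: "successively (adj B) (xs @ u # v # zs)" using s1 s4' by (rule successively_glue)
  have s6: "successively (adj B) ((u # ys) @ v # [u])" using s3 vu by (rule_tac xs = "u # ys" in successively_glue) auto
  have c1: "walk_weight B ((u # ys) @ v # [u]) = \<one>"
    using assms s6 by (intro short) (auto simp: closed_walk_def)
  have "hd (xs @ u # v # zs) = last (xs @ u # v # zs)"
    using assms by (cases xs) (auto simp: closed_walk_def)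
  then have c2: "walk_weight B (xs @ u # v # zs) = \<one>"
    using assms s5 by (intro short) (auto simp: closed_walk_def)
  have cl: "walk_weight B (u # ys @ [v]) \<in> carrier G" "edge_weight B v u \<in> carrier G" "edge_weight B u v \<in> carrier G"
    using s3 vu assms B by auto
  have "walk_weight B (u # ys @ [v]) \<otimes> edge_weight B v u = \<one>"
    using c1 walk_weight_append[OF B s6] cl by simp
  also have "\<one> = edge_weight B u v \<otimes> edge_weight B v u"
    using edge_weight_inverse B assms by simp
  finally have e: "walk_weight B (u # ys @ [v]) = edge_weight B u v" using cl by simp
  have "walk_weight B (xs @ u # ys @ v # zs) =
      walk_weight B (xs @ [u]) \<otimes> (walk_weight B (u # ys @ [v]) \<otimes> walk_weight B (v # zs))"
    using walk_weight_append[OF B s] walk_weight_append[OF B s2] by simp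
  also have "\<dots> = walk_weight B (xs @ u # v # zs)"
    using walk_weight_append[OF B s5] e by simp
  finally show ?thesis using c2 by simp
qed

end

lemma walk_weight_cong:
  assumes "successively (adj B) zs"
    "\<And>ps x y qs. zs = ps @ x # y # qs \<Longrightarrow> adj B' x y \<and> edge_weight B' x y = edge_weight B x y"
  shows "successively (adj B') zs \<and> walk_weight B' zs = walk_weight B zs"
  using assms
proof (induction zs rule: induct_list012)
  case (3 x y zs)
  have "adj B' x y \<and> edge_weight B' x y = edge_weight B x y" using 3(4)[of "[]"] by simp
  moreover have "successively (adj B') (y # zs) \<and> walk_weight B' (y # zs) = walk_weight B (y # zs)"
  proof (rule 3(2))
    show "successively (adj B) (y # zs)" using 3(3) by simp
    show "adj B' u v \<and> edge_weight B' u v = edge_weight B u v" if "y # zs = ps @ u # v # qs" for ps u v qs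
      using 3(4)[of "x # ps" u v qs] that by simp
  qed
  ultimately show ?case by simp
qed auto

text \<open>A shortest closed walk of nontrivial weight would have no chord, so that pivoting on its
  second edge replaces its first three edges by a single one and leaves the other edges alone.\<close>

lemma closed_walk_weight:
  assumes "B \<in> bases M" "closed_walk B xs"
  shows "walk_weight B xs = \<one>"
  using assms
\<comment> \<open>\<open>B\<close> varies in the induction because the shortened walk lives in the
  fundamental graph of the pivoted basis.\<close>
proof (induction "length xs" arbitrary: B xs rule: less_induct)
  case less
  note B = \<open>B \<in> bases M\<close>
  have IH: "walk_weight B' ys = \<one>"
    if "length ys < length xs" "B' \<in> bases M" "closed_walk B' ys" for B' ys
    using less.hyps that by blast
  note repeat = walk_weight_repeat[where n = "length xs", OF B IH[OF _ B]]
  note chord = walk_weight_chord[where n = "length xs", OF B IH[OF _ B]]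
  have sw: "successively (adj B) xs" and ends: "xs \<noteq> []" "hd xs = last xs"
    using less.prems by (auto simp: closed_walk_def)
  consider (short) s where "xs = [s]" | (two) s t where "xs = [s, t]" | (three) s t u where "xs = [s, t, u]"
    | (four) s t u v where "xs = [s, t, u, v]" | (long) s t u v w ws where "xs = s # t # u # v # w # ws"
    using ends(1) by (metis neq_Nil_conv)
  then show ?case
  proof cases
    case short
    then show ?thesis by simp
  next
    case two
    then show ?thesis using sw ends adj_neq by auto
  next
    case three
    then show ?thesis using sw ends edge_weight_inverse[OF B] B by auto
  next
    \<comment> \<open>The three edges would form a triangle, while the fundamental graph is
      bipartite.\<close>
    case four
    then have "adj B s t" "adj B t u" "adj B u s" using sw ends by auto
    then show ?thesis using adj_sides by blast
  next
    case long
    let ?r = "v # w # ws"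
    have last_r: "last ?r = s" using long ends by simp
    then have s_r: "s \<in> set ?r" by (metis last_in_set list.distinct(1))
    have e: "adj B s t" "adj B t u" "adj B u v" "adj B v w" "successively (adj B) ?r"
      using sw long by auto
    have split1: ?thesis if "t \<in> set ?r"
    proof -
      from that obtain ps qs where "?r = ps @ t # qs" by (meson split_list)
      then have "xs = [s] @ t # (u # ps) @ t # qs" using long by simp
      then show ?thesis using repeat[of "[s]" t "u # ps" qs] less.prems by simp
    qed
    have split2: ?thesis if "u \<in> set ?r"
    proof -
      from that obtain ps qs where "?r = ps @ u # qs" by (meson split_list)
      then have "xs = [s, t] @ u # ps @ u # qs" using long by simp
      then show ?thesis using repeat[of "[s, t]" u ps qs] less.prems by simp
    qed
    \<comment> \<open>If the walk ends right after \<open>w\<close>, then \<open>w\<close> is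
      \<open>s\<close> and the walk is a four-cycle; otherwise the edge from \<open>s\<close> to
      \<open>v\<close> is a chord.\<close>
    have split3: ?thesis if sv: "adj B s v"
    proof (cases ws)
      case Nil
      then have "xs = [s, t, u, v, s]" using long last_r by simp
      then show ?thesis using adj_four_cycle[OF B e(1,2,3)] sv adj_sym B by auto
    next
      case Cons
      have "xs = [] @ s # [t, u] @ v # w # ws" using long by simp
      then show ?thesis using chord[of "[]" s "[t, u]" v "w # ws"] less.prems sv Cons by simp
    qed
    \<comment> \<open>\<open>x\<close> is followed by another vertex, so the edge from
      \<open>t\<close> to \<open>x\<close> is not the first edge of the walk but a chord.\<close>
    have cross1: ?thesis if r: "?r = ps @ x # y # qs" and x: "adj B x t" for ps x y qs
    proof -
      have "xs = [s] @ t # (u # ps) @ x # y # qs" using long r by simp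
      then show ?thesis
        using chord[of "[s]" t "u # ps" x "y # qs"] less.prems x adj_sym by simp
    qed
    \<comment> \<open>If \<open>y\<close> is not the last vertex, its edge to \<open>t\<close> is a
      chord. If it is, then \<open>y\<close> is \<open>s\<close>, and the edge from \<open>u\<close>
      to \<open>x\<close> is a chord unless \<open>x\<close> is \<open>v\<close>, which would make
      \<open>v\<close> adjacent to \<open>s\<close>.\<close>
    have cross2: ?thesis
      if sv: "\<not> adj B s v" and r: "?r = ps @ x # y # qs" and x: "adj B x u" and y: "adj B y t" for ps x y qs
    proof (cases qs)
      case Cons
      have "xs = [s] @ t # (u # ps @ [x]) @ y # qs" using long r by simp
      then show ?thesis
        using chord[of "[s]" t "u # ps @ [x]" y qs] less.prems y adj_sym Cons by simp
    next
      case Nil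
      then have ys: "y = s" using r last_r by simp
      show ?thesis
      proof (cases ps)
        case Nil
        then have "v = x" "w = y" using r by auto
        then show ?thesis using sv ys e(4) adj_sym by blast
      next
        case (Cons p ps')
        have "xs = [s, t] @ u # ps @ x # y # qs" using long r by simp
        then show ?thesis
          using chord[of "[s, t]" u ps x "y # qs"] less.prems x adj_sym Cons by simp
      qed
    qed
    show ?thesis
    proof (rule ccontr)
      assume neq: "walk_weight B xs \<noteq> \<one>"
      let ?B = "pivot B t u"
      have tu: "t \<notin> set ?r" "u \<notin> set ?r" and sv: "\<not> adj B s v"
        using neq split1 split2 split3 by blast+
      have P: "?B \<in> bases M" using e pivot_basis by blast
      have "successively (adj ?B) ?r \<and> walk_weight ?B ?r = walk_weight B ?r"
      proof (rule walk_weight_cong[OF e(5)])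
        fix ps x y qs assume r: "?r = ps @ x # y # qs"
        have "adj B x y" using e(5) r by (simp add: successively_append_iff)
        moreover have "{x, y} \<inter> {t, u} = {}" using tu r by auto
        moreover have "\<not> (adj B x t \<and> adj B y u)" using neq cross1 r by blast
        moreover have "\<not> (adj B x u \<and> adj B y t)" using neq cross2[OF sv] r by blast
        ultimately show "adj ?B x y \<and> edge_weight ?B x y = edge_weight B x y"
          using pivot_parallel[OF B] e(2) by blast
      qed
      moreover note pivot_cross[OF B e(1,2,3) sv]
      ultimately have "closed_walk ?B (s # ?r)"
        and w: "walk_weight ?B (s # ?r) =
          edge_weight B s t \<otimes> (edge_weight B t u \<otimes> edge_weight B u v) \<otimes> walk_weight B ?r"
        using last_r by (auto simp: closed_walk_def)
      \<comment> \<open>The new walk has lost the two vertices \<open>t\<close> and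
        \<open>u\<close>.\<close>
      then have "walk_weight ?B (s # ?r) = \<one>"
        using IH[of "s # ?r" ?B] P long by (simp del: walk_weight.simps)
      moreover have "walk_weight B ?r \<in> carrier G" using B e by blast
      moreover have "walk_weight B xs =
          edge_weight B s t \<otimes> (edge_weight B t u \<otimes> (edge_weight B u v \<otimes> walk_weight B ?r))"
        unfolding long by simp
      ultimately have "walk_weight B xs = \<one>"
        using w edge_weight_closed[OF B e(1)] edge_weight_closed[OF B e(2)]
          edge_weight_closed[OF B e(3)] by (metis m_assoc m_closed)
      then show False using neq by simp
    qed
  qed
qed

subsection \<open>Potentials\<close>

text \<open>Since closed walks are trivial, the weight of a walk depends only on its ends. In each
  component of the fundamental graph, \<open>h v\<close> is the weight of any walk to
  \<open>v\<close> from a fixed root.\<close>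

lemma potential_exists:
  assumes "B \<in> bases M"
  obtains h where "h \<in> UNIV \<rightarrow> carrier G"
    "\<And>b e. b \<in> B \<Longrightarrow> e \<notin> B \<Longrightarrow> insert e (B - {b}) \<in> bases M \<Longrightarrow>
      \<psi> (insert e (B - {b})) \<otimes> h b = \<psi> B \<otimes> h e"
proof -
  define walk where "walk u v xs \<longleftrightarrow> successively (adj B) xs \<and> xs \<noteq> [] \<and> hd xs = u \<and> last xs = v"
    for u v xs
  have walk_snoc: "walk u w (xs @ [w]) \<and> walk_weight B (xs @ [w]) = walk_weight B xs \<otimes> edge_weight B v w"
    if uv: "walk u v xs" and "adj B v w" for u v w xs
  proof -
    obtain ys where ys: "xs = ys @ [v]" using uv unfolding walk_def by (metis append_butlast_last_id)
    have s: "successively (adj B) (ys @ v # [w])"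
      using that ys by (rule_tac xs = ys in successively_glue) (auto simp: walk_def)
    then show ?thesis
      using walk_weight_append[OF assms s] that assms unfolding walk_def ys by (cases ys) auto
  qed
  have walk_ex: "\<exists>xs. walk u v xs" if "(adj B)\<^sup>*\<^sup>* u v" for u v
    using that
  proof induction
    case base
    have "walk u u [u]" by (simp add: walk_def)
    then show ?case by blast
  next
    case step
    then show ?case using walk_snoc by blast
  qed
  have unique: "walk_weight B xs = walk_weight B ys" if xs: "walk u v xs" and ys: "walk u v ys" for u v xs ys
  proof -
    obtain xs' where xs': "xs = xs' @ [v]" using xs unfolding walk_def by (metis append_butlast_last_id)
    obtain ys' where ys': "rev ys = v # ys'"
      using ys unfolding walk_def by (metis hd_rev list.collapse rev_is_Nil_conv)
    have r: "successively (adj B) (rev ys)" "walk_weight B (rev ys) \<otimes> walk_weight B ys = \<one>"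
      using walk_weight_rev[OF assms] ys unfolding walk_def by auto
    have s: "successively (adj B) (xs' @ v # ys')"
      using xs xs' ys' r by (rule_tac xs = xs' in successively_glue) (auto simp: walk_def)
    have "last (v # ys') = u" using ys' ys unfolding walk_def by (metis last_rev)
    moreover have "hd (xs' @ v # ys') = u" using xs xs' unfolding walk_def by (cases xs') auto
    ultimately have "closed_walk B (xs' @ v # ys')" using s by (simp add: closed_walk_def)
    then have "walk_weight B xs \<otimes> walk_weight B (rev ys) = \<one>"
      using closed_walk_weight[OF assms] walk_weight_append[OF assms s] xs' ys' by metis
    moreover have "walk_weight B xs \<in> carrier G" "walk_weight B ys \<in> carrier G"
      "walk_weight B (rev ys) \<in> carrier G"
      using xs ys r assms by (auto simp: walk_def)
    ultimately show ?thesis using r(2) by (metis m_comm right_cancel)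
  qed
  \<comment> \<open>Adjacent vertices are reachable from the same vertices, so \<open>SOME\<close>
    is applied to equal predicates and picks one root per component.\<close>
  define root where "root v = (SOME r. (adj B)\<^sup>*\<^sup>* r v)" for v
  have root: "(adj B)\<^sup>*\<^sup>* (root v) v" for v
    unfolding root_def by (rule someI[of _ v]) auto
  define path where "path v = (SOME xs. walk (root v) v xs)" for v
  have path: "walk (root v) v (path v)" for v
    unfolding path_def using walk_ex[OF root] by (rule someI_ex)
  define h where "h v = walk_weight B (path v)" for v
  have h_closed: "h v \<in> carrier G" for v
    unfolding h_def using path[of v] assms by (auto simp: walk_def)
  have edge: "h v = h u \<otimes> edge_weight B u v" if uv: "adj B u v" for u v
  proof -
    have "(adj B)\<^sup>*\<^sup>* r u \<longleftrightarrow> (adj B)\<^sup>*\<^sup>* r v" for r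
      using uv adj_sym by (meson rtranclp.rtrancl_into_rtrancl)
    then have "root v = root u" unfolding root_def by simp
    then show ?thesis
      unfolding h_def using walk_snoc[OF path uv] unique path by metis
  qed
  show ?thesis
  proof (rule that)
    show "h \<in> UNIV \<rightarrow> carrier G" using h_closed by auto
    fix b e assume be: "b \<in> B" "e \<notin> B" "insert e (B - {b}) \<in> bases M"
    then have "h e = h b \<otimes> (\<psi> (insert e (B - {b})) \<otimes> inv \<psi> B)"
      using edge[of b e] by (simp add: adj_iff edge_weight_def)
    then have "h e \<otimes> inv \<one> = (h b \<otimes> \<psi> (insert e (B - {b}))) \<otimes> inv \<psi> B"
      using be h_closed assms by (simp add: m_assoc)
    then have "h e \<otimes> \<psi> B = (h b \<otimes> \<psi> (insert e (B - {b}))) \<otimes> \<one>"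
      using be h_closed assms by (subst (asm) frac_eq_iff) auto
    then show "\<psi> (insert e (B - {b})) \<otimes> h b = \<psi> B \<otimes> h e"
      using be h_closed assms by (simp add: m_comm)
  qed
qed

text \<open>The hypothesis says that \<psi> divided by the product of \<open>h\<close> is the same
  at \<open>B\<close> and at all bases one exchange away; the conclusion says so for the exchanged
  basis and its neighbours. In the cases with \<open>b = e'\<close> or \<open>e = b'\<close> the
  second exchange stays within one exchange of \<open>B\<close>.\<close>

lemma potential_exchange:
  assumes B: "B \<in> bases M" and h: "h \<in> UNIV \<rightarrow> carrier G"
    and pot: "\<And>b e. b \<in> B \<Longrightarrow> e \<notin> B \<Longrightarrow> insert e (B - {b}) \<in> bases M \<Longrightarrow>
      \<psi> (insert e (B - {b})) \<otimes> h b = \<psi> B \<otimes> h e"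
    and be': "b' \<in> B" "e' \<notin> B" "insert e' (B - {b'}) \<in> bases M"
    and be: "b \<in> insert e' (B - {b'})" "e \<notin> insert e' (B - {b'})"
      "insert e (insert e' (B - {b'}) - {b}) \<in> bases M"
  shows "\<psi> (insert e (insert e' (B - {b'}) - {b})) \<otimes> h b = \<psi> (insert e' (B - {b'})) \<otimes> h e"
proof -
  let ?P = "insert e' (B - {b'})" and ?N = "insert e (insert e' (B - {b'}) - {b})"
  have hc [simp]: "h x \<in> carrier G" for x using h by auto
  have c [simp]: "\<psi> B \<in> carrier G" "\<psi> ?P \<in> carrier G" "\<psi> ?N \<in> carrier G" using B be be' by auto
  have P: "\<psi> ?P \<otimes> h b' = \<psi> B \<otimes> h e'" using pot be' by simp
  consider "b = e'" "e = b'" | "b = e'" "e \<noteq> b'" | "b \<noteq> e'" "e = b'" | "b \<noteq> e'" "e \<noteq> b'" by blast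
  then show ?thesis
  proof cases
    case 1
    then have "?N = B" using be be' by auto
    then show ?thesis using 1 P by simp
  next
    case 2
    then have N: "?N = insert e (B - {b'})" "e \<notin> B" using be be' by auto
    then have "\<psi> ?N \<otimes> h b' = \<psi> B \<otimes> h e" using pot be be' by simp
    then have "(\<psi> ?N \<otimes> h b') \<otimes> (\<psi> B \<otimes> h e') = (\<psi> B \<otimes> h e) \<otimes> (\<psi> ?P \<otimes> h b')" using P by simp
    then have "(\<psi> B \<otimes> h b') \<otimes> (\<psi> ?N \<otimes> h e') = (\<psi> B \<otimes> h b') \<otimes> (\<psi> ?P \<otimes> h e)"
      by (simp add: m_ac)
    then have "\<psi> ?N \<otimes> h e' = \<psi> ?P \<otimes> h e" by (subst (asm) Units_l_cancel) auto
    then show ?thesis using 2 by simp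
  next
    case 3
    then have N: "?N = insert e' (B - {b})" "b \<in> B" using be be' by auto
    then have "\<psi> ?N \<otimes> h b = \<psi> B \<otimes> h e'" using pot be be' by metis
    then show ?thesis using P 3 by simp
  next
    case 4
    then have ne: "b \<in> B" "b \<noteq> b'" "e \<notin> B" "e \<noteq> e'" using be by auto
    have "\<psi> B \<otimes> \<psi> ?N \<otimes> (h b \<otimes> h b') = \<psi> B \<otimes> h e' \<otimes> (\<psi> B \<otimes> h e)"
      \<comment> \<open>The new basis is two exchanges from \<open>B\<close>. One of its two
        pairings with \<open>B\<close> consists of bases adjacent to \<open>B\<close>, where
        \<open>pot\<close> is available.\<close>
      using pivot_basis_cases[OF B ne(1) be'(1) ne(2,3) be'(2) ne(4) be(3) be'(3)]
    proof
      assume a: "insert e' (B - {b}) \<in> bases M \<and> insert e (B - {b'}) \<in> bases M"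
      then have "\<psi> B \<otimes> \<psi> ?N = \<psi> (insert e' (B - {b})) \<otimes> \<psi> (insert e (B - {b'}))"
        using B be be' ne by (intro pivot_value_cross) auto
      then have "\<psi> B \<otimes> \<psi> ?N \<otimes> (h b \<otimes> h b') =
          (\<psi> (insert e' (B - {b})) \<otimes> h b) \<otimes> (\<psi> (insert e (B - {b'})) \<otimes> h b')"
        using a by (simp add: m_ac)
      then show ?thesis using pot a ne be' by simp
    next
      assume a: "insert e (B - {b}) \<in> bases M"
      then have "\<psi> B \<otimes> \<psi> ?N = \<psi> (insert e (B - {b})) \<otimes> \<psi> ?P"
        using B be be' ne by (intro pivot_value_parallel) auto
      then have "\<psi> B \<otimes> \<psi> ?N \<otimes> (h b \<otimes> h b') = (\<psi> (insert e (B - {b})) \<otimes> h b) \<otimes> (\<psi> ?P \<otimes> h b')"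
        using a by (simp add: m_ac)
      also have "\<dots> = (\<psi> B \<otimes> h e) \<otimes> (\<psi> B \<otimes> h e')" using pot[OF ne(1,3) a] P by simp
      finally show ?thesis by (simp add: m_comm)
    qed
    also have "\<dots> = \<psi> ?P \<otimes> h b' \<otimes> (\<psi> B \<otimes> h e)" using P by simp
    finally have "(\<psi> B \<otimes> h b') \<otimes> (\<psi> ?N \<otimes> h b) = (\<psi> B \<otimes> h b') \<otimes> (\<psi> ?P \<otimes> h e)"
      by (simp add: m_ac)
    then show ?thesis by (subst (asm) Units_l_cancel) auto
  qed
qed

text \<open>Exchange \<open>B\<close> step by step towards \<open>B'\<close>; by
  \<open>potential_exchange\<close> the potential stays valid at each intermediate basis, which
  keeps the induction going.\<close>

lemma potential_product:
  assumes "B \<in> bases M" "B' \<in> bases M" and h: "h \<in> UNIV \<rightarrow> carrier G"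
    and pot: "\<And>b e. b \<in> B \<Longrightarrow> e \<notin> B \<Longrightarrow> insert e (B - {b}) \<in> bases M \<Longrightarrow>
      \<psi> (insert e (B - {b})) \<otimes> h b = \<psi> B \<otimes> h e"
  shows "\<psi> B' \<otimes> finprod G h B = \<psi> B \<otimes> finprod G h B'"
  using assms(1) pot
proof (induction "card (B - B')" arbitrary: B)
  case 0
  then have "B \<subseteq> B'" using finite_basis by auto
  then have "B = B'" using 0 assms(2) card_basis finite_basis card_subset_eq by metis
  then show ?case by simp
next
  case (Suc n)
  then obtain b where b: "b \<in> B" "b \<notin> B'" by (metis Diff_iff card.empty equals0I nat.distinct(1))
  obtain e where e: "e \<in> B'" "e \<notin> B" "insert e (B - {b}) \<in> bases M"
    using basis_exchange[OF Suc.prems(1) assms(2) b] .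
  let ?P = "insert e (B - {b})"
  have fin: "finite B" using finite_basis Suc.prems by blast
  have "?P - B' = (B - B') - {b}" using b e by auto
  then have n: "n = card (?P - B')" using Suc.hyps(2) b fin by simp
  have IH: "\<psi> B' \<otimes> finprod G h ?P = \<psi> ?P \<otimes> finprod G h B'"
    by (rule Suc.hyps(1)[OF n e(3)])
      (rule potential_exchange[OF Suc.prems(1) h Suc.prems(2) b(1) e(2,3)])
  have hc [simp]: "h x \<in> carrier G" for x using h by auto
  have fc [simp]: "finprod G h X \<in> carrier G" for X using hc by (intro finprod_closed) auto
  have c [simp]: "\<psi> B \<in> carrier G" "\<psi> B' \<in> carrier G" "\<psi> ?P \<in> carrier G"
    using Suc.prems assms e by auto
  have p1: "finprod G h ?P = h e \<otimes> finprod G h (B - {b})"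
    using fin e hc by (intro finprod_insert) auto
  have "B = insert b (B - {b})" using b by auto
  then have p2: "finprod G h B = h b \<otimes> finprod G h (B - {b})"
    using fin hc finprod_insert[of "B - {b}" b h] by auto
  have v: "\<psi> ?P \<otimes> h b = \<psi> B \<otimes> h e" using Suc.prems(2) b e by blast
  have "h e \<otimes> (\<psi> B' \<otimes> finprod G h B) = h b \<otimes> (\<psi> B' \<otimes> finprod G h ?P)"
    unfolding p1 p2 by (simp add: m_ac)
  also have "\<dots> = (\<psi> ?P \<otimes> h b) \<otimes> finprod G h B'" unfolding IH by (simp add: m_ac)
  also have "\<dots> = h e \<otimes> (\<psi> B \<otimes> finprod G h B')" unfolding v by (simp add: m_ac)
  finally show ?case by (subst (asm) Units_l_cancel) auto
qed

theorem balanced_is_rescaling: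
  obtains a h where "a \<in> carrier G" "h \<in> UNIV \<rightarrow> carrier G"
    "\<And>B. B \<in> bases M \<Longrightarrow> \<psi> B = a \<otimes> finprod G h B"
proof -
  obtain B where B: "B \<in> bases M" using rk_witness[of "ground M"] bases_iff by metis
  obtain h where h: "h \<in> UNIV \<rightarrow> carrier G"
    and pot: "\<And>b e. b \<in> B \<Longrightarrow> e \<notin> B \<Longrightarrow> insert e (B - {b}) \<in> bases M \<Longrightarrow>
      \<psi> (insert e (B - {b})) \<otimes> h b = \<psi> B \<otimes> h e"
    using potential_exists[OF B] by blast
  have fc [simp]: "finprod G h X \<in> carrier G" for X using h by (intro finprod_closed) auto
  show ?thesis
  proof (rule that[OF _ h])
    show "\<psi> B \<otimes> inv finprod G h B \<in> carrier G" using B by simp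
    fix B' assume B': "B' \<in> bases M"
    have "\<psi> B' \<otimes> inv \<one> = (\<psi> B \<otimes> finprod G h B') \<otimes> inv finprod G h B"
      using potential_product[OF B B' h pot] B B' by (subst frac_eq_iff) auto
    then show "\<psi> B' = \<psi> B \<otimes> inv finprod G h B \<otimes> finprod G h B'"
      using B B' by (simp add: m_ac)
  qed
qed

end

section \<open>Cross ratios and quadruples of circuits\<close>

text \<open>This is what the relations with a vanishing term give for the quotient of any two weak
  functions; \<open>balancedI\<close> lifts it to \<open>balanced_basis_function\<close> once the
  remaining cross ratios are known to be trivial.\<close>

locale degenerate_basis_function = basis_function M G \<psi>
  for M :: "'a indep_system" and G :: "('g, 'm) monoid_scheme" (structure) and \<psi> +
  assumes degenerate: "\<lbrakk>distinct [a, b, c, d]; {a, b, c, d} \<subseteq> S;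
      S - {a, b} \<in> bases M; S - {c, d} \<in> bases M; S - {a, c} \<in> bases M; S - {b, d} \<in> bases M;
      S - {a, d} \<notin> bases M \<or> S - {b, c} \<notin> bases M\<rbrakk> \<Longrightarrow>
      \<psi> (S - {a, b}) \<otimes> \<psi> (S - {c, d}) = \<psi> (S - {a, c}) \<otimes> \<psi> (S - {b, d})"
begin

definition neutral :: "'a set \<Rightarrow> 'a \<Rightarrow> 'a \<Rightarrow> 'a \<Rightarrow> 'a \<Rightarrow> bool" where
  "neutral S a b c d \<longleftrightarrow> \<psi> (S - {a, b}) \<otimes> \<psi> (S - {c, d}) = \<psi> (S - {a, c}) \<otimes> \<psi> (S - {b, d})"

context
  fixes q
  assumes quad: "circuit_quad M q"
begin

interpretation circuit_quad M q by (rule quad)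

text \<open>In fractions, x / y = x' / y' and z / w = z' / w', so the products of these quotients
  agree and are trivial together.\<close>

lemma cross_solve:
  assumes "x \<otimes> y' = y \<otimes> x'" "z \<otimes> w' = w \<otimes> z'" "x \<otimes> z = y \<otimes> w"
    "{x, x', y, y', z, z', w, w'} \<subseteq> carrier G"
  shows "x' \<otimes> z' = y' \<otimes> w'"
proof -
  have "(y \<otimes> w) \<otimes> (x' \<otimes> z') = (y \<otimes> x') \<otimes> (w \<otimes> z')" using assms(4) by (simp add: m_ac)
  also have "\<dots> = (x \<otimes> y') \<otimes> (z \<otimes> w')" using assms(1,2) by simp
  also have "\<dots> = (x \<otimes> z) \<otimes> (y' \<otimes> w')" using assms(4) by (simp add: m_ac)
  finally show ?thesis using assms(3,4) by (subst (asm) assms(3)) simp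
qed

text \<open>\<open>S - {x1, x1'}\<close> contains \<open>C1\<close> and is no basis. The degenerate
  relation for \<open>x1\<close>, \<open>x1'\<close>, \<open>x2\<close>, \<open>x3\<close> therefore
  says that replacing \<open>x1\<close> by \<open>x1'\<close> keeps the quotient of the two factors
  in which it occurs.\<close>

lemma neutral_change_elem:
  assumes S: "hull S" and C: "distinct [C1, C2, C3, C4]" "{C1, C2, C3, C4} \<subseteq> q"
    and x: "x1 \<in> \<Union>q - C1" "x2 \<in> \<Union>q - C2" "x3 \<in> \<Union>q - C3" "x4 \<in> \<Union>q - C4" "x1' \<in> \<Union>q - C1"
    and n: "neutral S x1 x2 x3 x4"
  shows "neutral S x1' x2 x3 x4"
proof (cases "x1 = x1'")
  case False
  have SF: "\<Union>q \<subseteq> S" using S by (simp add: hull_def)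
  have b: "S - {x1, x2} \<in> bases M" "S - {x1, x3} \<in> bases M"
    "S - {x1', x2} \<in> bases M" "S - {x1', x3} \<in> bases M"
    "S - {x3, x4} \<in> bases M" "S - {x2, x4} \<in> bases M"
    using hull_basis[OF S _ _ _ x(1,2)] hull_basis[OF S _ _ _ x(1,3)] hull_basis[OF S _ _ _ x(5,2)]
      hull_basis[OF S _ _ _ x(5,3)] hull_basis[OF S _ _ _ x(3,4)] hull_basis[OF S _ _ _ x(2,4)] C
    by simp_all
  have ne: "distinct [x1, x1', x2, x3]"
    using False quad_elems_neq[OF _ _ _ x(1,2)] quad_elems_neq[OF _ _ _ x(1,3)]
      quad_elems_neq[OF _ _ _ x(5,2)] quad_elems_neq[OF _ _ _ x(5,3)] quad_elems_neq[OF _ _ _ x(2,3)] C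
    by simp
  have nb: "S - {x1', x1} \<notin> bases M" using hull_not_basis[OF S, of C1] C x(1,5) by simp
  have "\<psi> (S - {x2, x1'}) \<otimes> \<psi> (S - {x1, x3}) = \<psi> (S - {x2, x1}) \<otimes> \<psi> (S - {x1', x3})"
    using ne b nb SF x by (intro degenerate) (auto simp: insert_commute)
  then have e: "\<psi> (S - {x1, x2}) \<otimes> \<psi> (S - {x1', x3}) = \<psi> (S - {x1, x3}) \<otimes> \<psi> (S - {x1', x2})"
    using b by (simp add: insert_commute m_comm)
  show ?thesis
    unfolding neutral_def
    \<comment> \<open>The factors without \<open>x1\<close> do not change, so the second premise is
      commutativity.\<close>
    by (rule cross_solve[OF e _ n[unfolded neutral_def]]) (use b in \<open>auto simp: m_comm\<close>)
qed (use n in simp)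

text \<open>These symmetries bring \<open>x2\<close>, \<open>x3\<close> and \<open>x4\<close> into
  the first position, the one that \<open>neutral_change_elem\<close> handles.\<close>

lemma neutral_perm:
  assumes S: "hull S" and C: "distinct [C1, C2, C3, C4]" "{C1, C2, C3, C4} \<subseteq> q"
    and x: "x1 \<in> \<Union>q - C1" "x2 \<in> \<Union>q - C2" "x3 \<in> \<Union>q - C3" "x4 \<in> \<Union>q - C4"
  shows "neutral S x2 x1 x4 x3 \<longleftrightarrow> neutral S x1 x2 x3 x4"
    "neutral S x3 x1 x4 x2 \<longleftrightarrow> neutral S x1 x2 x3 x4"
    "neutral S x4 x3 x2 x1 \<longleftrightarrow> neutral S x1 x2 x3 x4"
proof -
  have "S - {x1, x2} \<in> bases M" "S - {x1, x3} \<in> bases M" "S - {x3, x4} \<in> bases M" "S - {x2, x4} \<in> bases M"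
    using hull_basis[OF S _ _ _ x(1,2)] hull_basis[OF S _ _ _ x(1,3)] hull_basis[OF S _ _ _ x(3,4)]
      hull_basis[OF S _ _ _ x(2,4)] C by simp_all
  then show "neutral S x2 x1 x4 x3 \<longleftrightarrow> neutral S x1 x2 x3 x4"
    "neutral S x3 x1 x4 x2 \<longleftrightarrow> neutral S x1 x2 x3 x4"
    "neutral S x4 x3 x2 x1 \<longleftrightarrow> neutral S x1 x2 x3 x4"
    unfolding neutral_def by (auto simp: insert_commute m_comm)
qed

lemma neutral_change_elems:
  assumes S: "hull S" and C: "distinct [C1, C2, C3, C4]" "{C1, C2, C3, C4} \<subseteq> q"
    and x: "x1 \<in> \<Union>q - C1" "x2 \<in> \<Union>q - C2" "x3 \<in> \<Union>q - C3" "x4 \<in> \<Union>q - C4"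
    and y: "y1 \<in> \<Union>q - C1" "y2 \<in> \<Union>q - C2" "y3 \<in> \<Union>q - C3" "y4 \<in> \<Union>q - C4"
    and n: "neutral S x1 x2 x3 x4"
  shows "neutral S y1 y2 y3 y4"
proof -
  have "neutral S y1 x2 x3 x4" by (rule neutral_change_elem[OF S C x y(1) n])
  then have "neutral S x2 y1 x4 x3" using neutral_perm(1)[OF S C y(1) x(2,3,4)] by simp
  then have "neutral S y2 y1 x4 x3"
    using neutral_change_elem[OF S _ _ x(2) y(1) x(4,3) y(2)] C by auto
  then have "neutral S y1 y2 x3 x4" using neutral_perm(1)[OF S C y(1,2) x(3,4)] by simp
  then have "neutral S x3 y1 x4 y2" using neutral_perm(2)[OF S C y(1,2) x(3,4)] by simp
  then have "neutral S y3 y1 x4 y2"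
    using neutral_change_elem[OF S _ _ x(3) y(1) x(4) y(2,3)] C by auto
  then have "neutral S y1 y2 y3 x4" using neutral_perm(2)[OF S C y(1,2,3) x(4)] by simp
  then have "neutral S x4 y3 y2 y1" using neutral_perm(3)[OF S C y(1,2,3) x(4)] by simp
  then have "neutral S y4 y3 y2 y1"
    using neutral_change_elem[OF S _ _ x(4) y(3,2,1,4)] C by auto
  then show ?thesis using neutral_perm(3)[OF S C y] by simp
qed

text \<open>The degenerate relation is applied in \<open>S\<close> with \<open>y\<close> in place of
  \<open>x1\<close>. There the complement of \<open>y\<close> and \<open>x\<close> is
  \<open>S - {x1, x}\<close>, which contains \<open>C1\<close> because \<open>x\<close> is outside
  the union of \<open>q\<close>.\<close>

lemma hull_exchange_ratio:
  assumes S: "hull S" and S': "hull (insert y (S - {x}))" and xy: "x \<in> S" "x \<notin> \<Union>q" "y \<notin> S"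
    and C: "distinct [C1, C2, C3]" "{C1, C2, C3} \<subseteq> q"
    and x: "x1 \<in> \<Union>q - C1" "x2 \<in> \<Union>q - C2" "x3 \<in> \<Union>q - C3"
  shows "\<psi> (S - {x1, x2}) \<otimes> \<psi> (insert y (S - {x}) - {x1, x3}) =
    \<psi> (S - {x1, x3}) \<otimes> \<psi> (insert y (S - {x}) - {x1, x2})"
proof -
  let ?S' = "insert y (S - {x})" and ?U = "insert y (S - {x1})"
  have SF: "\<Union>q \<subseteq> S" using S by (simp add: hull_def)
  have ne: "distinct [x1, x2, x3]"
    using quad_elems_neq[OF _ _ _ x(1,2)] quad_elems_neq[OF _ _ _ x(1,3)] quad_elems_neq[OF _ _ _ x(2,3)] C
    by simp
  have ne': "x \<notin> {x1, x2, x3, y}" "y \<notin> {x1, x2, x3}" using xy x SF by auto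
  have eq: "S - {x1, x2} = ?U - {y, x2}" "?S' - {x1, x3} = ?U - {x3, x}"
    "S - {x1, x3} = ?U - {y, x3}" "?S' - {x1, x2} = ?U - {x2, x}" "S - {x1, x} = ?U - {y, x}"
    using ne ne' xy by auto
  have "S - {x1, x2} \<in> bases M" "S - {x1, x3} \<in> bases M" "?S' - {x1, x3} \<in> bases M" "?S' - {x1, x2} \<in> bases M"
    using hull_basis[OF S _ _ _ x(1,2)] hull_basis[OF S _ _ _ x(1,3)]
      hull_basis[OF S' _ _ _ x(1,2)] hull_basis[OF S' _ _ _ x(1,3)] C by simp_all
  moreover have "S - {x1, x} \<notin> bases M"
    using hull_not_basis[OF S, of C1 x1 x] C x xy by auto
  ultimately show ?thesis
    unfolding eq using ne ne' xy x SF by (intro degenerate) auto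
qed

text \<open>One hull is turned into the other by single exchanges outside the union of
  \<open>q\<close>, each of which leaves the two relevant quotients alone.\<close>

lemma neutral_change_hull:
  assumes S: "hull S" and S': "hull S'" and C: "distinct [C1, C2, C3, C4]" "{C1, C2, C3, C4} \<subseteq> q"
    and x: "x1 \<in> \<Union>q - C1" "x2 \<in> \<Union>q - C2" "x3 \<in> \<Union>q - C3" "x4 \<in> \<Union>q - C4"
    and n: "neutral S x1 x2 x3 x4"
  shows "neutral S' x1 x2 x3 x4"
  using S n
proof (induction "card (S - S')" arbitrary: S)
  case 0
  have "finite S" "finite S'" "card S = card S'"
    using 0 S' finite_ground finite_subset unfolding hull_def by auto
  then have "S = S'" using 0 card_subset_eq[of S' S] by auto
  then show ?case using 0 by simp
next
  case (Suc n)
  then obtain x where x': "x \<in> S" "x \<notin> S'"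
    by (metis Diff_iff card.empty equals0I nat.distinct(1))
  have SF: "\<Union>q \<subseteq> S" "\<Union>q \<subseteq> S'" and finS: "finite S" and Sg: "S \<subseteq> ground M" "S' \<subseteq> ground M"
    using Suc.prems S' finite_ground finite_subset unfolding hull_def by blast+
  have b: "S - {x1, x2} \<in> bases M" "S' - {x1, x2} \<in> bases M"
    using hull_basis[OF Suc.prems(1) _ _ _ x(1,2)] hull_basis[OF S' _ _ _ x(1,2)] C by simp_all
  have "x \<in> S - {x1, x2}" "x \<notin> S' - {x1, x2}" using x x' SF by auto
  \<comment> \<open>Exchanging in the basis without \<open>x1\<close> and \<open>x2\<close> and
    adding both back afterwards ensures that the new set is again a hull.\<close>
  from basis_exchange[OF b this] obtain y where
    y: "y \<in> S' - {x1, x2}" "y \<notin> S - {x1, x2}" "insert y (S - {x1, x2} - {x}) \<in> bases M" .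
  have ne: "x1 \<noteq> x2" using quad_elems_neq[OF _ _ _ x(1,2)] C by simp
  let ?S = "insert y (S - {x})"
  have yS: "y \<notin> S" "x \<noteq> y" using x' y by auto
  have "hull (insert x1 (insert x2 (insert y (S - {x1, x2} - {x}))))"
    using y x x' ne SF Sg by (intro hull_insert_basis) auto
  moreover have "insert x1 (insert x2 (insert y (S - {x1, x2} - {x}))) = ?S"
    using x x' SF y by auto
  ultimately have h: "hull ?S" by simp
  have r: "\<psi> (S - {u, v}) \<otimes> \<psi> (?S - {u, w}) = \<psi> (S - {u, w}) \<otimes> \<psi> (?S - {u, v})"
    if "distinct [D1, D2, D3]" "{D1, D2, D3} \<subseteq> q" "u \<in> \<Union>q - D1" "v \<in> \<Union>q - D2" "w \<in> \<Union>q - D3"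
    for u v w D1 D2 D3
    using hull_exchange_ratio[OF Suc.prems(1) h x'(1) _ yS(1) that] x' SF by auto
  have cl: "T - {x1, x2} \<in> bases M" "T - {x1, x3} \<in> bases M" "T - {x3, x4} \<in> bases M" "T - {x2, x4} \<in> bases M"
    if "hull T" for T
    using hull_basis[OF that _ _ _ x(1,2)] hull_basis[OF that _ _ _ x(1,3)]
      hull_basis[OF that _ _ _ x(3,4)] hull_basis[OF that _ _ _ x(2,4)] C by simp_all
  have "neutral ?S x1 x2 x3 x4"
    unfolding neutral_def
  proof (rule cross_solve)
    show "\<psi> (S - {x1, x2}) \<otimes> \<psi> (?S - {x1, x3}) = \<psi> (S - {x1, x3}) \<otimes> \<psi> (?S - {x1, x2})"
      using r[OF _ _ x(1,2,3)] C by auto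
    show "\<psi> (S - {x3, x4}) \<otimes> \<psi> (?S - {x2, x4}) = \<psi> (S - {x2, x4}) \<otimes> \<psi> (?S - {x3, x4})"
      using r[OF _ _ x(4,3,2)] C by (auto simp: insert_commute)
    show "\<psi> (S - {x1, x2}) \<otimes> \<psi> (S - {x3, x4}) = \<psi> (S - {x1, x3}) \<otimes> \<psi> (S - {x2, x4})"
      using Suc.prems(2) by (simp add: neutral_def)
  qed (use cl[OF h] cl[OF Suc.prems(1)] in auto)
  moreover have "n = card (?S - S')"
  proof -
    have "?S - S' = (S - S') - {x}" using y by auto
    then show ?thesis using Suc.hyps(2) x' finS by simp
  qed
  ultimately show ?case using Suc.hyps(1) h by blast
qed

end

text \<open>For six bases, \<open>circuit_quad_of_bases\<close> finds a quadruple, and neutrality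
  moves from the given hull and elements to the wanted ones. All orderings of the circuits are
  assumed because the order of \<open>a\<close>, \<open>b\<close>, \<open>c\<close>,
  \<open>d\<close> is arbitrary.\<close>

lemma balancedI:
  assumes "\<And>q. circuit_quad M q \<Longrightarrow> \<exists>S f. circuit_quad.hull M q S \<and> (\<forall>C\<in>q. f C \<in> \<Union>q - C) \<and>
    (\<forall>C1\<in>q. \<forall>C2\<in>q. \<forall>C3\<in>q. \<forall>C4\<in>q. distinct [C1, C2, C3, C4] \<longrightarrow> neutral S (f C1) (f C2) (f C3) (f C4))"
  shows "balanced_basis_function M G \<psi>"
proof unfold_locales
  fix a b c d S
  assume ne: "distinct [a, b, c, d]" and sub: "{a, b, c, d} \<subseteq> S"
    and bs: "S - {a, b} \<in> bases M" "S - {c, d} \<in> bases M" "S - {a, c} \<in> bases M" "S - {b, d} \<in> bases M"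
  show "\<psi> (S - {a, b}) \<otimes> \<psi> (S - {c, d}) = \<psi> (S - {a, c}) \<otimes> \<psi> (S - {b, d})"
  proof (cases "S - {a, d} \<in> bases M \<and> S - {b, c} \<in> bases M")
    case False
    then show ?thesis using degenerate ne sub bs by blast
  next
    case True
    have "S \<subseteq> ground M"
      using basis_subset_ground[OF bs(1)] basis_subset_ground[OF bs(2)] ne sub by auto
    have Sab: "S = insert a (insert b (S - {a, b}))" using sub by auto
    have cS: "card S = rk M (ground M) + 2"
      using ne card_basis[OF bs(1)] finite_basis[OF bs(1)] by (subst Sab) auto
    have c4: "card {a, b, c, d} = 4" using ne by auto
    have pairs: "\<forall>x\<in>{a, b, c, d}. \<forall>y\<in>{a, b, c, d}. x \<noteq> y \<longrightarrow> S - {x, y} \<in> bases M"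
      using bs True by (auto simp: insert_commute)
    obtain k where k: "inj_on k {a, b, c, d}" "circuit_quad M (k ` {a, b, c, d})"
      "circuit_quad.hull M (k ` {a, b, c, d}) S" "\<forall>x\<in>{a, b, c, d}. x \<in> \<Union>(k ` {a, b, c, d}) - k x"
      by (rule circuit_quad_of_bases[OF \<open>S \<subseteq> ground M\<close> cS sub c4 pairs])
    let ?q = "k ` {a, b, c, d}"
    obtain S0 f where S0: "circuit_quad.hull M ?q S0" and f: "\<forall>C\<in>?q. f C \<in> \<Union>?q - C"
      and nf: "\<forall>C1\<in>?q. \<forall>C2\<in>?q. \<forall>C3\<in>?q. \<forall>C4\<in>?q. distinct [C1, C2, C3, C4] \<longrightarrow>
        neutral S0 (f C1) (f C2) (f C3) (f C4)"
      using assms[OF k(2)] by (elim exE conjE)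
    have dk: "distinct [k a, k b, k c, k d]" "{k a, k b, k c, k d} \<subseteq> ?q"
      using k(1) ne by (auto simp: inj_on_def)
    have fe: "f (k a) \<in> \<Union>?q - k a" "f (k b) \<in> \<Union>?q - k b" "f (k c) \<in> \<Union>?q - k c" "f (k d) \<in> \<Union>?q - k d"
      by (rule f[rule_format]; simp)+
    have xe: "a \<in> \<Union>?q - k a" "b \<in> \<Union>?q - k b" "c \<in> \<Union>?q - k c" "d \<in> \<Union>?q - k d"
      by (rule k(4)[rule_format]; simp)+
    have "neutral S0 (f (k a)) (f (k b)) (f (k c)) (f (k d))" using nf dk(1) by simp
    then have "neutral S (f (k a)) (f (k b)) (f (k c)) (f (k d))"
      by (rule neutral_change_hull[OF k(2) S0 k(3) dk fe])
    then have "neutral S a b c d"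
      by (rule neutral_change_elems[OF k(2,3) dk fe xe])
    then show ?thesis by (simp add: neutral_def)
  qed
qed

end

section \<open>Hyperfields\<close>

context hyperfield
begin

lemma hneg_closed [simp]: "x \<in> carrier H \<Longrightarrow> hneg H x \<in> carrier H"
  and hadd_hneg: "x \<in> carrier H \<Longrightarrow> hzero H \<in> x \<boxplus> hneg H x"
  using theI'[OF hneg_ex1[of x]] unfolding hneg_def by auto

lemma hneg_eqI:
  assumes "x \<in> carrier H" "y \<in> carrier H" "hzero H \<in> x \<boxplus> y"
  shows "hneg H x = y"
  using hneg_ex1[of x] assms hneg_closed hadd_hneg by blast

lemma hneg_hneg [simp]: "x \<in> carrier H \<Longrightarrow> hneg H (hneg H x) = x"
  using hneg_eqI[of "hneg H x" x] hadd_hneg[of x] hadd_commute[of x "hneg H x"] by simp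

lemma hadd_zero_right: "x \<in> carrier H \<Longrightarrow> x \<boxplus> hzero H = {x}"
  using hadd_commute hadd_zero hzero_closed by simp

lemma hneg_zero [simp]: "hneg H (hzero H) = hzero H"
  using hneg_eqI hadd_zero hzero_closed by simp

lemma hzero_mult_right [simp]: "x \<in> carrier H \<Longrightarrow> x \<otimes> hzero H = hzero H"
  using hzero_mult m_comm hzero_closed by simp

lemma hneg_mult:
  assumes "a \<in> carrier H" "x \<in> carrier H"
  shows "hneg H (a \<otimes> x) = a \<otimes> hneg H x"
proof (rule hneg_eqI)
  have "a \<otimes> hzero H \<in> (\<lambda>t. a \<otimes> t) ` (x \<boxplus> hneg H x)" using hadd_hneg assms by blast
  then show "hzero H \<in> (a \<otimes> x) \<boxplus> (a \<otimes> hneg H x)" using hdistrib assms by simp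
qed (use assms in auto)

lemma hneg_zero_iff: "x \<in> carrier H \<Longrightarrow> hneg H x = hzero H \<longleftrightarrow> x = hzero H"
  using hneg_hneg hneg_zero by metis

lemma units_closed: "x \<in> hunits H \<Longrightarrow> x \<in> carrier H"
  by (simp add: hunits_def)

lemma hneg_units [simp]: "x \<in> hunits H \<Longrightarrow> hneg H x \<in> hunits H"
  using hneg_zero_iff by (simp add: hunits_def)

lemma hone_units: "\<one> \<in> hunits H"
  using hzero_neq_one by (auto simp: hunits_def)

abbreviation unit_group where "unit_group \<equiv> H\<lparr>carrier := hunits H\<rparr>"

lemma unit_group_comm_group: "comm_group unit_group"
proof -
  interpret G: group unit_group by (rule hunits_group)
  show ?thesis by (rule G.group_comm_groupI) (simp add: m_comm units_closed)
qed

sublocale U: comm_group unit_group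
  by (rule unit_group_comm_group)

abbreviation uinv where "uinv \<equiv> m_inv unit_group"

lemma units_mult [simp]: "x \<in> hunits H \<Longrightarrow> y \<in> hunits H \<Longrightarrow> x \<otimes> y \<in> hunits H"
  using U.m_closed by simp

lemma uinv_units [simp]: "x \<in> hunits H \<Longrightarrow> uinv x \<in> hunits H"
  using U.inv_closed by simp

lemma uinv_left [simp]: "x \<in> hunits H \<Longrightarrow> uinv x \<otimes> x = \<one>"
  using U.l_inv by simp

lemma units_pow: "x \<in> hunits H \<Longrightarrow> x [^] (n::nat) \<in> hunits H"
  by (induction n) (simp_all add: hone_units)

lemma units_cancel:
  assumes "x \<in> hunits H" "y \<in> carrier H" "z \<in> carrier H" "x \<otimes> y = x \<otimes> z"
  shows "y = z"
proof -
  have "uinv x \<otimes> x \<otimes> y = uinv x \<otimes> x \<otimes> z"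
    using assms units_closed uinv_units by (simp add: m_assoc del: uinv_left)
  then show ?thesis using assms by simp
qed

text \<open>Potentials are multiplied in the group of units, whereas rescaling is stated with
  products in \<open>H\<close>.\<close>

lemma finprod_unit_group:
  assumes "finite A" "h \<in> A \<rightarrow> hunits H"
  shows "finprod unit_group h A = finprod H h A"
  using assms
proof (induction A)
  case empty
  then show ?case by (simp add: U.finprod_empty)
next
  case (insert x A)
  have "h \<in> A \<rightarrow> carrier H" "h x \<in> carrier H" using insert units_closed by auto
  then show ?case using insert by (simp add: U.finprod_insert Pi_def)
qed

lemma hsum_zeros:
  assumes "set zs \<subseteq> {hzero H}"
  shows "hsum H zs = {hzero H}"
  using assms
proof (induction zs)
  case Nil
  then show ?case by (simp add: hsum_def)
next
  case (Cons z zs)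
  then show ?case using hadd_zero hzero_closed by (simp add: hsum_def hset_add_def)
qed

lemma hsum_three_zeros:
  assumes "set zs \<subseteq> {hzero H}" "t0 \<in> carrier H" "t1 \<in> carrier H" "t2 \<in> carrier H"
    and "hzero H \<in> hsum H (t0 # t1 # t2 # zs)"
  shows "hneg H t0 \<in> t1 \<boxplus> t2"
proof -
  have "hsum H (t0 # t1 # t2 # zs) = hset_add H {t0} (hset_add H {t1} (hset_add H {t2} (hsum H zs)))"
    by (simp add: hsum_def)
  also have "\<dots> = hset_add H {t0} (t1 \<boxplus> t2)"
    using hsum_zeros[OF assms(1)] hadd_zero_right assms by (simp add: hset_add_def)
  finally obtain w where w: "w \<in> t1 \<boxplus> t2" "hzero H \<in> t0 \<boxplus> w"
    using assms by (auto simp: hset_add_def)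
  have "w \<in> carrier H" using w hadd_closed assms by blast
  then show ?thesis using hneg_eqI w assms by metis
qed

end

section \<open>Weak Grassmann--Pluecker functions\<close>

locale gp_setting = matroid M + hyperfield H
  for M :: "'a indep_system" and H :: "('h, 'm) hyperstruct_scheme" (structure)
begin

abbreviation E where "E \<equiv> ground M"
abbreviation d where "d \<equiv> rk M (ground M)"

lemma weak_GP_closed: "\<phi> \<in> weak_GP H M \<Longrightarrow> xs \<in> tuples E d \<Longrightarrow> \<phi> xs \<in> carrier H"
  by (auto simp: weak_GP_def Let_def)

lemma weak_GP_not_distinct: "\<phi> \<in> weak_GP H M \<Longrightarrow> xs \<in> tuples E d \<Longrightarrow> \<not> distinct xs \<Longrightarrow> \<phi> xs = hzero H"
  by (auto simp: weak_GP_def Let_def alternating_def)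

lemma weak_GP_permute:
  "\<phi> \<in> weak_GP H M \<Longrightarrow> xs \<in> tuples E d \<Longrightarrow> \<sigma> permutes {..<d} \<Longrightarrow>
    \<phi> (permute_list \<sigma> xs) = (if evenperm \<sigma> then \<phi> xs else hneg H (\<phi> xs))"
  by (auto simp: weak_GP_def Let_def alternating_def)

lemma tuples_permute:
  assumes "xs \<in> tuples E d" "ys \<in> tuples E d" "distinct xs" "set xs = set ys"
  obtains \<sigma> where "\<sigma> permutes {..<d}" "permute_list \<sigma> xs = ys"
proof -
  have l: "length xs = d" "length ys = d" using assms by (auto simp: tuples_def)
  have "distinct ys" using assms l by (metis card_distinct distinct_card)
  then have "mset ys = mset xs" using assms set_eq_iff_mset_eq_distinct by metis
  then show ?thesis using that l mset_eq_permutation[of ys xs] by metis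
qed

lemma weak_GP_nonzero_iff:
  assumes \<phi>: "\<phi> \<in> weak_GP H M" and xs: "xs \<in> tuples E d"
  shows "\<phi> xs \<noteq> hzero H \<longleftrightarrow> set xs \<in> bases M"
proof
  show "set xs \<in> bases M" if "\<phi> xs \<noteq> hzero H"
    using \<phi> xs that by (auto simp: weak_GP_def Let_def)
next
  assume "set xs \<in> bases M"
  then have "set xs \<in> set ` {ys \<in> tuples E d. \<phi> ys \<noteq> hzero H}"
    using \<phi> by (simp add: weak_GP_def Let_def)
  then obtain ys where ys: "ys \<in> tuples E d" "\<phi> ys \<noteq> hzero H" "set ys = set xs" by auto
  then have "distinct ys" using weak_GP_not_distinct \<phi> by blast
  then obtain \<sigma> where "\<sigma> permutes {..<d}" "permute_list \<sigma> ys = xs"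
    using tuples_permute ys xs by metis
  then show "\<phi> xs \<noteq> hzero H"
    using weak_GP_permute[OF \<phi> ys(1)] ys(2) hneg_zero_iff weak_GP_closed[OF \<phi> ys(1)] by metis
qed

lemma weak_GP_units:
  "\<phi> \<in> weak_GP H M \<Longrightarrow> xs \<in> tuples E d \<Longrightarrow> set xs \<in> bases M \<Longrightarrow> \<phi> xs \<in> hunits H"
  using weak_GP_nonzero_iff weak_GP_closed by (simp add: hunits_def)

definition gp_term :: "nat \<Rightarrow> ('a list \<Rightarrow> 'h) \<Rightarrow> 'a \<Rightarrow> 'a \<Rightarrow> 'a \<Rightarrow> 'a \<Rightarrow> 'a list \<Rightarrow> 'h" where
  "gp_term k \<phi> u v w z J = (hneg H \<one> [^] Suc k) \<otimes> \<phi> (u # v # J) \<otimes> \<phi> (w # z # J)"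

text \<open>In the relation for \<open>{b, c, e} \<union> J\<close> and \<open>{a} \<union> J\<close>, the terms for elements of \<open>J\<close> vanish.\<close>

lemma gp_three_terms:
  assumes \<phi>: "\<phi> \<in> weak_GP H M" and J: "length J + 2 = d" "distinct (a # b # c # e # J)"
    "set (a # b # c # e # J) \<subseteq> E"
  shows "hneg H (gp_term 0 \<phi> c e b a J) \<in> gp_term 1 \<phi> b e c a J \<boxplus> gp_term 2 \<phi> b c e a J"
proof -
  let ?xs = "b # c # e # J" and ?ys = "a # J"
  have t: "u # v # J \<in> tuples E d" if "u \<in> E" "v \<in> E" for u v
    using that J by (auto simp: tuples_def)
  have neg1: "hneg H \<one> [^] Suc k \<in> carrier H" for k
    using units_pow hneg_units hone_units units_closed by blast
  have c: "gp_term k \<phi> u v w z J \<in> carrier H" if "u \<in> E" "v \<in> E" "w \<in> E" "z \<in> E" for k u v w z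
    unfolding gp_term_def using that neg1 t weak_GP_closed[OF \<phi>] by simp
  have sub: "set ?xs - set ?ys \<subseteq> {b, c, e}" by auto
  then have "card (set ?xs - set ?ys) \<le> card {b, c, e}" by (intro card_mono) auto
  also have "\<dots> \<le> 3" by (simp add: card_insert_if)
  finally have "card (set ?xs - set ?ys) \<le> 3" .
  then have z: "hzero H \<in> hsum H (gp_terms H \<phi> ?xs ?ys)"
    using \<phi> J unfolding weak_GP_def Let_def by auto
  let ?f = "\<lambda>k. (hneg H \<one> [^] Suc k) \<otimes> \<phi> (take k ?xs @ drop (Suc k) ?xs) \<otimes> \<phi> (?xs ! k # ?ys)"
  have "[0..<length ?xs] = 0 # 1 # 2 # [3..<length ?xs]"
    by (simp add: upt_rec numeral_eq_Suc)
  then have g: "gp_terms H \<phi> ?xs ?ys =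
      gp_term 0 \<phi> c e b a J # gp_term 1 \<phi> b e c a J # gp_term 2 \<phi> b c e a J # map ?f [3..<length ?xs]"
    unfolding gp_terms_def gp_term_def by (simp add: numeral_eq_Suc)
  \<comment> \<open>From position 3 on the entries of \<open>?xs\<close> come from \<open>J\<close>,
    so the second factor has a repeated entry.\<close>
  have "?f k = hzero H" if "k \<in> {3..<length ?xs}" for k
  proof -
    have k: "3 \<le> k" "k < length ?xs" using that by auto
    have "?xs ! k = J ! (k - 3)" using k by (simp add: nth_Cons' numeral_eq_Suc)
    moreover have "k - 3 < length J" using k by auto
    ultimately have "?xs ! k \<in> set ?ys" "?xs ! k \<in> E" using J by auto
    then have "\<phi> (?xs ! k # ?ys) = hzero H"
      using J by (intro weak_GP_not_distinct[OF \<phi>]) (auto simp: tuples_def)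
    moreover have "\<phi> (take k ?xs @ drop (Suc k) ?xs) \<in> carrier H"
    proof (rule weak_GP_closed[OF \<phi>])
      have "set (take k ?xs @ drop (Suc k) ?xs) \<subseteq> set ?xs"
        using set_take_subset set_drop_subset by (metis Un_least set_append)
      then show "take k ?xs @ drop (Suc k) ?xs \<in> tuples E d"
        using J k by (auto simp: tuples_def)
    qed
    ultimately show ?thesis using neg1 by simp
  qed
  then have "set (map ?f [3..<length ?xs]) \<subseteq> {hzero H}"
    unfolding set_map set_upt image_subset_iff singleton_iff by blast
  moreover have "{a, b, c, e} \<subseteq> E" using J by auto
  ultimately show ?thesis using z unfolding g by (intro hsum_three_zeros) (auto intro: c)
qed

text \<open>The three-term relation puts the negative of its first term into the sum of the other
  two. Dividing by that negative gives a pair whose sum contains \<one>, an element of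
  \<open>X_set H\<close>.\<close>

definition cross_ratio :: "('a list \<Rightarrow> 'h) \<Rightarrow> 'a \<Rightarrow> 'a \<Rightarrow> 'a \<Rightarrow> 'a \<Rightarrow> 'a list \<Rightarrow> 'h \<times> 'h" where
  "cross_ratio \<phi> a b c e J =
    (let k = uinv (hneg H (gp_term 0 \<phi> c e b a J))
     in (k \<otimes> gp_term 1 \<phi> b e c a J, k \<otimes> gp_term 2 \<phi> b c e a J))"

definition all_pairs_bases where
  "all_pairs_bases a b c e J \<longleftrightarrow> length J + 2 = d \<and> distinct (a # b # c # e # J) \<and>
    set (a # b # c # e # J) \<subseteq> E \<and>
    (\<forall>u\<in>{a, b, c, e}. \<forall>v\<in>{a, b, c, e}. u \<noteq> v \<longrightarrow> set (u # v # J) \<in> bases M)"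

lemma gp_term_units:
  assumes "\<phi> \<in> weak_GP H M" "set (u # v # J) \<in> bases M" "set (w # z # J) \<in> bases M" "length J + 2 = d"
  shows "gp_term k \<phi> u v w z J \<in> hunits H"
proof -
  have "u # v # J \<in> tuples E d" "w # z # J \<in> tuples E d"
    using assms basis_subset_ground[OF assms(2)] basis_subset_ground[OF assms(3)] by (auto simp: tuples_def)
  then show ?thesis
    unfolding gp_term_def using weak_GP_units[OF assms(1)] assms units_pow hone_units by simp
qed

lemma cross_ratio_X:
  assumes \<phi>: "\<phi> \<in> weak_GP H M" and J: "all_pairs_bases a b c e J"
  shows "cross_ratio \<phi> a b c e J \<in> X_set H"
proof -
  let ?t0 = "gp_term 0 \<phi> c e b a J" and ?t1 = "gp_term 1 \<phi> b e c a J" and ?t2 = "gp_term 2 \<phi> b c e a J"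
  have u: "?t0 \<in> hunits H" "?t1 \<in> hunits H" "?t2 \<in> hunits H"
    using J by (auto simp: all_pairs_bases_def intro!: gp_term_units[OF \<phi>])
  let ?k = "uinv (hneg H ?t0)"
  have k: "?k \<in> hunits H" using u by simp
  have "hneg H ?t0 \<in> ?t1 \<boxplus> ?t2"
    using J by (intro gp_three_terms[OF \<phi>]) (auto simp: all_pairs_bases_def)
  then have "?k \<otimes> hneg H ?t0 \<in> (\<lambda>t. ?k \<otimes> t) ` (?t1 \<boxplus> ?t2)" by blast
  then have "\<one> \<in> (?k \<otimes> ?t1) \<boxplus> (?k \<otimes> ?t2)" using hdistrib k u units_closed by simp
  then show ?thesis using k u by (simp add: cross_ratio_def Let_def X_set_def)
qed

section \<open>The quotient of two weak Grassmann--Pluecker functions\<close>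

definition ratio :: "('a list \<Rightarrow> 'h) \<Rightarrow> ('a list \<Rightarrow> 'h) \<Rightarrow> 'a set \<Rightarrow> 'h" where
  "ratio \<phi>1 \<phi>2 B = (let xs = (SOME xs. set xs = B \<and> distinct xs) in \<phi>1 xs \<otimes> uinv (\<phi>2 xs))"

context
  fixes \<phi>1 \<phi>2
  assumes \<phi>1: "\<phi>1 \<in> weak_GP H M" and \<phi>2: "\<phi>2 \<in> weak_GP H M"
begin

abbreviation \<rho> where "\<rho> \<equiv> ratio \<phi>1 \<phi>2"

text \<open>Reordering a basis changes both functions by the same sign, so the ordering chosen in
  \<open>ratio\<close> does not matter.\<close>

lemma ratio_units_and_eq:
  assumes "set xs \<in> bases M" "length xs = d"
  shows "\<rho> (set xs) \<in> hunits H" "\<phi>1 xs = \<rho> (set xs) \<otimes> \<phi>2 xs"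
proof -
  let ?B = "set xs"
  define ys where "ys = (SOME ys. set ys = ?B \<and> distinct ys)"
  have ys: "distinct ys" "set ys = ?B"
    using someI_ex[OF finite_distinct_list[of ?B]] finite_basis assms unfolding ys_def by auto
  have "length ys = d" using ys assms card_basis distinct_card by metis
  then have t: "xs \<in> tuples E d" "ys \<in> tuples E d"
    using ys assms basis_subset_ground by (auto simp: tuples_def)
  have u: "\<phi>1 ys \<in> hunits H" "\<phi>2 ys \<in> hunits H"
    using weak_GP_units \<phi>1 \<phi>2 t ys assms by auto
  have \<rho>: "\<rho> ?B = \<phi>1 ys \<otimes> uinv (\<phi>2 ys)" by (simp add: ratio_def ys_def Let_def)
  then show ru: "\<rho> ?B \<in> hunits H" using u by simp
  have e: "\<phi>1 ys = \<rho> ?B \<otimes> \<phi>2 ys"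
    unfolding \<rho> using u units_closed by (simp add: m_assoc)
  obtain \<sigma> where s: "\<sigma> permutes {..<d}" "permute_list \<sigma> ys = xs"
    using tuples_permute[OF t(2,1) ys] .
  show "\<phi>1 xs = \<rho> ?B \<otimes> \<phi>2 xs"
    using weak_GP_permute[OF \<phi>1 t(2) s(1)] weak_GP_permute[OF \<phi>2 t(2) s(1)] s(2)
      e ru u units_closed hneg_mult by auto
qed

lemma gp_term_ratio:
  assumes "set (u # v # J) \<in> bases M" "set (w # z # J) \<in> bases M" "length J + 2 = d"
  shows "gp_term k \<phi>1 u v w z J =
    \<rho> (set (u # v # J)) \<otimes> \<rho> (set (w # z # J)) \<otimes> gp_term k \<phi>2 u v w z J"
proof -
  have l: "length (u # v # J) = d" "length (w # z # J) = d" using assms by auto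
  then have "u # v # J \<in> tuples E d" "w # z # J \<in> tuples E d"
    using assms basis_subset_ground[OF assms(1)] basis_subset_ground[OF assms(2)] by (auto simp: tuples_def)
  then have "\<phi>2 (u # v # J) \<in> carrier H" "\<phi>2 (w # z # J) \<in> carrier H"
    using weak_GP_closed \<phi>2 by auto
  moreover have "hneg H \<one> [^] Suc k \<in> carrier H"
    using units_pow hneg_units hone_units units_closed by blast
  moreover note ratio_units_and_eq[OF assms(1) l(1)] ratio_units_and_eq[OF assms(2) l(2)]
  ultimately show ?thesis
    unfolding gp_term_def using units_closed by (simp add: m_ac del: nat_pow_Suc set_simps)
qed

text \<open>A missing basis kills the third term, and adding zero is single-valued, so the relation
  becomes an equation between two units for each function. Dividing the two equations removes the
  signs.\<close>

lemma ratio_degenerate: "degenerate_basis_function M unit_group \<rho>"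
proof unfold_locales
  show "\<rho> B \<in> carrier unit_group" if B: "B \<in> bases M" for B
  proof -
    obtain xs where "distinct xs" "set xs = B" using B finite_basis finite_distinct_list by metis
    moreover from this have "length xs = d" using B card_basis distinct_card by metis
    ultimately show ?thesis using ratio_units_and_eq(1) that by auto
  qed
  fix a b c e S
  assume ne: "distinct [a, b, c, e]" and sub: "{a, b, c, e} \<subseteq> S"
    and bs: "S - {a, b} \<in> bases M" "S - {c, e} \<in> bases M" "S - {a, c} \<in> bases M" "S - {b, e} \<in> bases M"
    and deg: "S - {a, e} \<notin> bases M \<or> S - {b, c} \<notin> bases M"
  have SE: "S \<subseteq> E" using basis_subset_ground[OF bs(1)] basis_subset_ground[OF bs(2)] ne sub by auto
  then have "finite (S - {a, b, c, e})" using finite_ground finite_subset by blast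
  then obtain J where J: "distinct J" "set J = S - {a, b, c, e}" using finite_distinct_list by metis
  have sets: "set (c # e # J) = S - {a, b}" "set (b # a # J) = S - {c, e}" "set (b # e # J) = S - {a, c}"
    "set (c # a # J) = S - {b, e}" "set (b # c # J) = S - {a, e}" "set (e # a # J) = S - {b, c}"
    using ne sub J by auto
  have "distinct (c # e # J)" using ne J by auto
  then have l: "length J + 2 = d" using card_basis[OF bs(1)] distinct_card sets(1) by fastforce
  have dist: "distinct (a # b # c # e # J)" and inE: "set (a # b # c # e # J) \<subseteq> E"
    using ne J sub SE by auto
  have sum: "hneg H (gp_term 0 \<phi> c e b a J) = gp_term 1 \<phi> b e c a J" if \<phi>: "\<phi> \<in> weak_GP H M" for \<phi>
  proof -
    have t: "b # c # J \<in> tuples E d" "e # a # J \<in> tuples E d"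
      using inE l by (auto simp: tuples_def)
    have "hneg H \<one> [^] Suc 2 \<in> carrier H"
      using units_pow hneg_units hone_units units_closed by blast
    moreover have "\<phi> (b # c # J) = hzero H \<or> \<phi> (e # a # J) = hzero H"
      using deg weak_GP_nonzero_iff[OF \<phi> t(1)] weak_GP_nonzero_iff[OF \<phi> t(2)] sets(5,6) by metis
    ultimately have "gp_term 2 \<phi> b c e a J = hzero H"
      unfolding gp_term_def using weak_GP_closed[OF \<phi>] t hzero_mult by auto
    moreover have "gp_term 1 \<phi> b e c a J \<in> hunits H"
      using bs sets l by (intro gp_term_units[OF \<phi>]) (auto simp del: set_simps)
    ultimately show ?thesis
      using gp_three_terms[OF \<phi> l dist inE] hadd_zero_right units_closed by simp
  qed
  let ?P = "\<rho> (S - {a, b}) \<otimes> \<rho> (S - {c, e})" and ?Q = "\<rho> (S - {a, c}) \<otimes> \<rho> (S - {b, e})"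
  have \<rho>: "\<rho> (S - {a, b}) \<in> hunits H" "\<rho> (S - {c, e}) \<in> hunits H"
    "\<rho> (S - {a, c}) \<in> hunits H" "\<rho> (S - {b, e}) \<in> hunits H"
    using ratio_units_and_eq(1)[of "c # e # J"] ratio_units_and_eq(1)[of "b # a # J"]
      ratio_units_and_eq(1)[of "b # e # J"] ratio_units_and_eq(1)[of "c # a # J"] bs l
    unfolding sets by auto
  have t0: "gp_term 0 \<phi>2 c e b a J \<in> hunits H"
    using bs sets l by (intro gp_term_units[OF \<phi>2]) (auto simp del: set_simps)
  have "gp_term 0 \<phi>1 c e b a J = ?P \<otimes> gp_term 0 \<phi>2 c e b a J"
    using gp_term_ratio[of c e J b a 0] bs l unfolding sets by simp
  then have "hneg H (gp_term 0 \<phi>1 c e b a J) = ?P \<otimes> hneg H (gp_term 0 \<phi>2 c e b a J)"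
    using hneg_mult \<rho> t0 units_closed by simp
  moreover have "gp_term 1 \<phi>1 b e c a J = ?Q \<otimes> gp_term 1 \<phi>2 b e c a J"
    using gp_term_ratio[of b e J c a 1] bs l unfolding sets by simp
  ultimately have "?P \<otimes> hneg H (gp_term 0 \<phi>2 c e b a J) = ?Q \<otimes> hneg H (gp_term 0 \<phi>2 c e b a J)"
    using sum[OF \<phi>1] sum[OF \<phi>2] by simp
  then have "?P = ?Q"
    using U.right_cancel[of "hneg H (gp_term 0 \<phi>2 c e b a J)" ?P ?Q] \<rho> t0 by simp
  then show "\<rho> (S - {a, b}) \<otimes>\<^bsub>unit_group\<^esub> \<rho> (S - {c, e}) =
      \<rho> (S - {a, c}) \<otimes>\<^bsub>unit_group\<^esub> \<rho> (S - {b, e})" by simp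
qed

text \<open>Passing from \<phi>2 to \<phi>1 multiplies the three terms by \<open>P\<close>,
  \<open>Q\<close> and \<open>R\<close>. The cross ratio records the quotients of terms, so equality
  makes all three factors equal.\<close>

lemma cross_ratio_eq_imp:
  assumes J: "all_pairs_bases a b c e J"
    and eq: "cross_ratio \<phi>1 a b c e J = cross_ratio \<phi>2 a b c e J"
  shows "\<rho> (set (c # e # J)) \<otimes> \<rho> (set (b # a # J)) = \<rho> (set (b # e # J)) \<otimes> \<rho> (set (c # a # J))"
    "\<rho> (set (c # e # J)) \<otimes> \<rho> (set (b # a # J)) = \<rho> (set (b # c # J)) \<otimes> \<rho> (set (e # a # J))"
proof -
  have l: "length J + 2 = d" and ne: "distinct [a, b, c, e]"
    and pairs: "\<forall>u\<in>{a, b, c, e}. \<forall>v\<in>{a, b, c, e}. u \<noteq> v \<longrightarrow> set (u # v # J) \<in> bases M"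
    using J by (auto simp: all_pairs_bases_def)
  have bs: "set (c # e # J) \<in> bases M" "set (b # a # J) \<in> bases M" "set (b # e # J) \<in> bases M"
    "set (c # a # J) \<in> bases M" "set (b # c # J) \<in> bases M" "set (e # a # J) \<in> bases M"
    by (rule pairs[rule_format]; use ne in auto)+
  define P Q R where "P = \<rho> (set (c # e # J)) \<otimes> \<rho> (set (b # a # J))"
    and "Q = \<rho> (set (b # e # J)) \<otimes> \<rho> (set (c # a # J))"
    and "R = \<rho> (set (b # c # J)) \<otimes> \<rho> (set (e # a # J))"
  have PQR: "P \<in> hunits H" "Q \<in> hunits H" "R \<in> hunits H"
    unfolding P_def Q_def R_def using bs l ratio_units_and_eq(1) by (auto simp del: set_simps)
  define s0 s1 s2 where "s0 = hneg H (gp_term 0 \<phi>2 c e b a J)" and "s1 = gp_term 1 \<phi>2 b e c a J"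
    and "s2 = gp_term 2 \<phi>2 b c e a J"
  have g0: "gp_term 0 \<phi>2 c e b a J \<in> hunits H" and s12: "s1 \<in> hunits H" "s2 \<in> hunits H"
    unfolding s1_def s2_def using bs l gp_term_units[OF \<phi>2] by (auto simp del: set_simps)
  then have s: "s0 \<in> hunits H" "s1 \<in> hunits H" "s2 \<in> hunits H" by (simp_all add: s0_def)
  have t: "hneg H (gp_term 0 \<phi>1 c e b a J) = P \<otimes> s0" "gp_term 1 \<phi>1 b e c a J = Q \<otimes> s1"
    "gp_term 2 \<phi>1 b c e a J = R \<otimes> s2"
    using gp_term_ratio[OF bs(1,2) l, of 0] gp_term_ratio[OF bs(3,4) l, of 1]
      gp_term_ratio[OF bs(5,6) l, of 2] hneg_mult g0 PQR units_closed
    unfolding P_def Q_def R_def s0_def s1_def s2_def by simp_all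
  have "uinv (P \<otimes> s0) \<otimes> (Q \<otimes> s1) = uinv s0 \<otimes> s1" "uinv (P \<otimes> s0) \<otimes> (R \<otimes> s2) = uinv s0 \<otimes> s2"
    using eq t unfolding cross_ratio_def Let_def s0_def[symmetric] s1_def[symmetric] s2_def[symmetric]
    by simp_all
  moreover have "P = X" if "uinv (P \<otimes> s0) \<otimes> (X \<otimes> x) = uinv s0 \<otimes> x" "X \<in> hunits H" "x \<in> hunits H" for X x
  proof -
    have "X \<otimes> x \<otimes> uinv (P \<otimes> s0) = x \<otimes> uinv s0"
      using that PQR s units_closed m_comm by simp
    then have "X \<otimes> x \<otimes> s0 = x \<otimes> (P \<otimes> s0)"
      using U.frac_eq_iff[of "X \<otimes> x" "P \<otimes> s0" x s0] that PQR s by simp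
    then have "(x \<otimes> s0) \<otimes> X = (x \<otimes> s0) \<otimes> P"
      using that PQR s units_closed by (simp add: m_ac)
    then show ?thesis using units_cancel[of "x \<otimes> s0" X P] that PQR s units_closed by simp
  qed
  ultimately have "P = Q" "P = R" using PQR s by auto
  then show "\<rho> (set (c # e # J)) \<otimes> \<rho> (set (b # a # J)) = \<rho> (set (b # e # J)) \<otimes> \<rho> (set (c # a # J))"
    "\<rho> (set (c # e # J)) \<otimes> \<rho> (set (b # a # J)) = \<rho> (set (b # c # J)) \<otimes> \<rho> (set (e # a # J))"
    by (simp_all only: P_def Q_def R_def)
qed

lemma rescaling_relI_balanced:
  assumes "balanced_basis_function M unit_group \<rho>"
  shows "(\<phi>1, \<phi>2) \<in> rescaling_rel H M"
proof -
  interpret R: balanced_basis_function M unit_group \<rho> by (rule assms)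
  obtain a h where a: "a \<in> hunits H" and h: "h \<in> UNIV \<rightarrow> hunits H"
    and \<rho>: "\<And>B. B \<in> bases M \<Longrightarrow> \<rho> B = a \<otimes> finprod unit_group h B"
    using R.balanced_is_rescaling by auto
  have "\<phi>1 xs = a \<otimes> (\<Otimes>j\<in>{..<d}. h (xs ! j)) \<otimes> \<phi>2 xs" if xs: "xs \<in> tuples E d" for xs
  proof (cases "set xs \<in> bases M")
    case False
    then have z: "\<phi>1 xs = hzero H" "\<phi>2 xs = hzero H"
      using weak_GP_nonzero_iff \<phi>1 \<phi>2 xs by auto
    have "(\<Otimes>j\<in>{..<d}. h (xs ! j)) \<in> carrier H"
      using h units_closed by (intro finprod_closed) auto
    then show ?thesis unfolding z using a units_closed by simp
  next
    case True
    have l: "length xs = d" using xs by (simp add: tuples_def)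
    then have "distinct xs" using True card_basis card_distinct by metis
    then have inj: "inj_on ((!) xs) {..<d}" using l by (auto simp: inj_on_def nth_eq_iff_index_eq)
    have im: "set xs = (!) xs ` {..<d}" using l by (auto simp: set_conv_nth)
    have "finprod unit_group h (set xs) = finprod H h (set xs)"
      using h by (intro finprod_unit_group) auto
    also have "\<dots> = (\<Otimes>j\<in>{..<d}. h (xs ! j))"
      unfolding im using h units_closed by (intro finprod_reindex[OF _ inj]) auto
    finally show ?thesis using ratio_units_and_eq(2)[OF True l] \<rho>[OF True] by simp
  qed
  then show ?thesis
    unfolding rescaling_rel_def Let_def using \<phi>1 \<phi>2 a h by blast
qed

end

section \<open>Cross ratios determine the rescaling class\<close>

definition quad_frame :: "'a set set \<Rightarrow> 'a \<Rightarrow> 'a \<Rightarrow> 'a \<Rightarrow> 'a \<Rightarrow> 'a list \<Rightarrow> bool" where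
  "quad_frame q a b c e J \<longleftrightarrow> all_pairs_bases a b c e J \<and>
    circuit_quad.hull M q (set (a # b # c # e # J)) \<and>
    (\<exists>C1 C2 C3 C4. distinct [C1, C2, C3, C4] \<and> q = {C1, C2, C3, C4} \<and>
      a \<in> \<Union>q - C1 \<and> b \<in> \<Union>q - C2 \<and> c \<in> \<Union>q - C3 \<and> e \<in> \<Union>q - C4)"

text \<open>The pair \<open>cross_ratio\<close> depends on the chosen elements and their order, so
  each quadruple gets a frame at which all functions are evaluated.\<close>

lemma quad_frame_exists:
  assumes "circuit_quad M q"
  obtains a b c e J where "quad_frame q a b c e J"
proof -
  interpret circuit_quad M q by (rule assms)
  obtain C1 C2 C3 C4 where C: "q = {C1, C2, C3, C4}" "distinct [C1, C2, C3, C4]"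
  proof -
    obtain Cs where Cs: "distinct Cs" "set Cs = q" "length Cs = 4"
      using q_card finite_distinct_list[of q] distinct_card
      by (metis card.infinite zero_neq_numeral)
    then obtain C1 C2 C3 C4 where "Cs = [C1, C2, C3, C4]"
      by (auto simp: numeral_eq_Suc length_Suc_conv)
    then show ?thesis using that[of C1 C2 C3 C4] Cs by auto
  qed
  have Cq: "C1 \<in> q" "C2 \<in> q" "C3 \<in> q" "C4 \<in> q" using C by auto
  obtain a where a: "a \<in> \<Union>q - C1" using quad_avoiding_elem[OF Cq(1)] by blast
  obtain b where b: "b \<in> \<Union>q - C2" using quad_avoiding_elem[OF Cq(2)] by blast
  obtain c where c: "c \<in> \<Union>q - C3" using quad_avoiding_elem[OF Cq(3)] by blast
  obtain e where e: "e \<in> \<Union>q - C4" using quad_avoiding_elem[OF Cq(4)] by blast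
  obtain S where S: "hull S" by (rule hull_exists)
  have ne: "distinct [a, b, c, e]"
    using quad_elems_neq[OF _ _ _ a b] quad_elems_neq[OF _ _ _ a c] quad_elems_neq[OF _ _ _ a e]
      quad_elems_neq[OF _ _ _ b c] quad_elems_neq[OF _ _ _ b e] quad_elems_neq[OF _ _ _ c e] Cq C(2)
    by simp
  have SE: "S \<subseteq> E" and SF: "\<Union>q \<subseteq> S" using S by (auto simp: hull_def)
  have sub: "a \<in> S" "b \<in> S" "c \<in> S" "e \<in> S" using a b c e SF by blast+
  have "finite (S - {a, b, c, e})" using SE finite_ground finite_subset by blast
  then obtain J where J: "distinct J" "set J = S - {a, b, c, e}" using finite_distinct_list by metis
  have bs: "S - {a, b} \<in> bases M" "S - {a, c} \<in> bases M" "S - {a, e} \<in> bases M"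
    "S - {b, c} \<in> bases M" "S - {b, e} \<in> bases M" "S - {c, e} \<in> bases M"
    using hull_basis[OF S _ _ _ a b] hull_basis[OF S _ _ _ a c] hull_basis[OF S _ _ _ a e]
      hull_basis[OF S _ _ _ b c] hull_basis[OF S _ _ _ b e] hull_basis[OF S _ _ _ c e] Cq C(2)
    by simp_all
  have sets: "set (c # e # J) = S - {a, b}" "set (b # a # J) = S - {c, e}" "set (b # e # J) = S - {a, c}"
    "set (c # a # J) = S - {b, e}" "set (b # c # J) = S - {a, e}" "set (e # a # J) = S - {b, c}"
    "set (a # b # c # e # J) = S"
    using ne sub J by auto
  have "distinct (c # e # J)" using ne J by auto
  then have l: "length J + 2 = d" using card_basis[OF bs(1)] distinct_card sets(1) by fastforce
  have "set (c # e # J) \<in> bases M" "set (b # a # J) \<in> bases M" "set (b # e # J) \<in> bases M"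
    "set (c # a # J) \<in> bases M" "set (b # c # J) \<in> bases M" "set (e # a # J) \<in> bases M"
    unfolding sets by (rule bs)+
  note pairs = this[unfolded list.set]
  have "set (u # v # J) \<in> bases M" if "u \<in> {a, b, c, e}" "v \<in> {a, b, c, e}" "u \<noteq> v" for u v
    using that pairs by (elim insertE emptyE) (simp_all add: insert_commute)
  moreover have "distinct (a # b # c # e # J)" using ne J by auto
  ultimately have "all_pairs_bases a b c e J"
    unfolding all_pairs_bases_def using l SE sets(7) by blast
  then show ?thesis
    using that[of a b c e J] S C a b c e unfolding quad_frame_def sets(7) by blast
qed

lemma cross_ratios_determine_class:
  assumes \<phi>: "\<phi>1 \<in> weak_GP H M" "\<phi>2 \<in> weak_GP H M"
    and eq: "\<And>q. circuit_quad M q \<Longrightarrow> \<exists>a b c e J. quad_frame q a b c e J \<and>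
      cross_ratio \<phi>1 a b c e J = cross_ratio \<phi>2 a b c e J"
  shows "(\<phi>1, \<phi>2) \<in> rescaling_rel H M"
proof -
  let ?r = "ratio \<phi>1 \<phi>2"
  interpret D: degenerate_basis_function M unit_group ?r by (rule ratio_degenerate[OF \<phi>])
  have "balanced_basis_function M unit_group ?r"
  proof (rule D.balancedI)
    fix q assume q: "circuit_quad M q"
    interpret circuit_quad M q by (rule q)
    obtain a b c e J C1 C2 C3 C4 where J: "all_pairs_bases a b c e J"
      and h: "hull (set (a # b # c # e # J))"
      and C: "distinct [C1, C2, C3, C4]" "q = {C1, C2, C3, C4}"
      and x: "a \<in> \<Union>q - C1" "b \<in> \<Union>q - C2" "c \<in> \<Union>q - C3" "e \<in> \<Union>q - C4"
      and cr: "cross_ratio \<phi>1 a b c e J = cross_ratio \<phi>2 a b c e J"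
      using eq[OF q] unfolding quad_frame_def by blast
    let ?S = "set (a # b # c # e # J)"
    define f where "f = (\<lambda>C. if C = C1 then a else if C = C2 then b else if C = C3 then c else e)"
    have f: "f C1 = a" "f C2 = b" "f C3 = c" "f C4 = e" using C(1) by (auto simp: f_def)
    have ne: "distinct (a # b # c # e # J)" using J by (simp add: all_pairs_bases_def)
    have sets: "set (c # e # J) = ?S - {a, b}" "set (b # a # J) = ?S - {c, e}" "set (b # e # J) = ?S - {a, c}"
      "set (c # a # J) = ?S - {b, e}" "set (b # c # J) = ?S - {a, e}" "set (e # a # J) = ?S - {b, c}"
      using ne by auto
    define p where "p u v = ?r (?S - {u, v})" for u v
    have pc: "p u v = p v u" for u v by (simp add: p_def insert_commute)
    have ne': "distinct [a, b, c, e]"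
      and pairs: "\<forall>u\<in>{a, b, c, e}. \<forall>v\<in>{a, b, c, e}. u \<noteq> v \<longrightarrow> set (u # v # J) \<in> bases M"
      using J by (auto simp: all_pairs_bases_def)
    have "?S - {a, b} \<in> bases M" "?S - {a, c} \<in> bases M" "?S - {a, e} \<in> bases M"
      "?S - {b, c} \<in> bases M" "?S - {b, e} \<in> bases M" "?S - {c, e} \<in> bases M"
      unfolding sets[symmetric] by (rule pairs[rule_format]; use ne' in auto)+
    then have cl: "p a b \<in> carrier H" "p a c \<in> carrier H" "p a e \<in> carrier H"
      "p b c \<in> carrier H" "p b e \<in> carrier H" "p c e \<in> carrier H"
      unfolding p_def using D.value_closed units_closed by simp_all
    have E1: "p a b \<otimes> p c e = p a c \<otimes> p b e" and E2: "p a b \<otimes> p c e = p a e \<otimes> p b c"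
      using cross_ratio_eq_imp[OF \<phi> J cr] unfolding sets p_def by simp_all
    \<comment> \<open>Four elements have three pairings, so neutrality in every order amounts to
      equality of the three products, that is, to \<open>E1\<close> and \<open>E2\<close>.\<close>
    have "D.neutral ?S (f D1) (f D2) (f D3) (f D4)"
      if "D1 \<in> q" "D2 \<in> q" "D3 \<in> q" "D4 \<in> q" and D: "distinct [D1, D2, D3, D4]" for D1 D2 D3 D4
    proof -
      have E: "p a b \<otimes> p c e = p a c \<otimes> p b e" "p a b \<otimes> p c e = p a e \<otimes> p b c"
        "p c e \<otimes> p a b = p a c \<otimes> p b e" "p b e \<otimes> p a c = p a c \<otimes> p b e"
        "p b c \<otimes> p a e = p a c \<otimes> p b e" "p a e \<otimes> p b c = p a c \<otimes> p b e"
        using E1 E2 m_comm cl by metis+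
      have pp: "p b a = p a b" "p c a = p a c" "p e a = p a e" "p c b = p b c" "p e b = p b e" "p e c = p c e"
        using pc by auto
      have "p (f D1) (f D2) \<otimes> p (f D3) (f D4) = p (f D1) (f D3) \<otimes> p (f D2) (f D4)"
        using that C unfolding C(2) by (elim insertE emptyE) (simp_all add: f pp E(1,3-6))
      then show ?thesis unfolding D.neutral_def p_def by simp
    qed
    moreover have "\<forall>C\<in>q. f C \<in> \<Union>q - C"
    proof
      fix C assume "C \<in> q"
      then consider "C = C1" | "C = C2" | "C = C3" | "C = C4" using C(2) by blast
      then show "f C \<in> \<Union>q - C" using f x by cases simp_all
    qed
    ultimately show "\<exists>S f. hull S \<and> (\<forall>C\<in>q. f C \<in> \<Union>q - C) \<and>
      (\<forall>C1\<in>q. \<forall>C2\<in>q. \<forall>C3\<in>q. \<forall>C4\<in>q. distinct [C1, C2, C3, C4] \<longrightarrow>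
        D.neutral S (f C1) (f C2) (f C3) (f C4))"
      using h by blast
  qed
  then show ?thesis by (rule rescaling_relI_balanced[OF \<phi>])
qed

theorem card_rescaling_classes_le:
  assumes "finite (carrier H)"
  shows "card (rescaling_classes H M) \<le> card (X_set H) ^ num_dim1_quads M"
proof -
  let ?Q = "{q. q \<subseteq> circuits M \<and> card q = 4 \<and> union_dim M (\<Union>q) = 1}"
  let ?R = "rescaling_rel H M"
  have Q: "circuit_quad M q \<longleftrightarrow> q \<in> ?Q" for q
    by (auto simp: circuit_quad_def circuit_quad_axioms_def matroid_axioms)
  have "\<exists>t. case t of (a, b, c, e, J) \<Rightarrow> quad_frame q a b c e J" if q: "circuit_quad M q" for q
  proof -
    obtain a b c e J where "quad_frame q a b c e J" using quad_frame_exists[OF q] .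
    then show ?thesis by (intro exI[of _ "(a, b, c, e, J)"]) simp
  qed
  then have "\<forall>q\<in>?Q. \<exists>t. case t of (a, b, c, e, J) \<Rightarrow> quad_frame q a b c e J"
    unfolding Q[symmetric] Ball_def by blast
  from bchoice[OF this] obtain D
    where D: "\<forall>q\<in>?Q. case D q of (a, b, c, e, J) \<Rightarrow> quad_frame q a b c e J" by (elim exE)
  define F where "F \<phi> = (\<lambda>q\<in>?Q. case D q of (a, b, c, e, J) \<Rightarrow> cross_ratio \<phi> a b c e J)" for \<phi>
  have F: "F \<phi> \<in> ?Q \<rightarrow>\<^sub>E X_set H" if "\<phi> \<in> weak_GP H M" for \<phi>
  proof (rule PiE_I)
    fix q assume q: "q \<in> ?Q"
    obtain a b c e J where "D q = (a, b, c, e, J)" by (metis prod_cases5)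
    then show "F \<phi> q \<in> X_set H"
      using q bspec[OF D q] cross_ratio_X[OF that] by (simp add: F_def quad_frame_def)
  next
    fix q assume "q \<notin> ?Q"
    then show "F \<phi> q = undefined" unfolding F_def restrict_def by (rule if_not_P)
  qed
  have det: "(\<phi>1, \<phi>2) \<in> ?R" if \<phi>: "\<phi>1 \<in> weak_GP H M" "\<phi>2 \<in> weak_GP H M" and eq: "F \<phi>1 = F \<phi>2" for \<phi>1 \<phi>2
  proof (rule cross_ratios_determine_class[OF \<phi>])
    fix q assume "circuit_quad M q"
    then have q: "q \<in> ?Q" using Q by simp
    obtain a b c e J where t: "D q = (a, b, c, e, J)" by (metis prod_cases5)
    have "F \<phi>1 q = F \<phi>2 q" using eq by simp
    then show "\<exists>a b c e J. quad_frame q a b c e J \<and> cross_ratio \<phi>1 a b c e J = cross_ratio \<phi>2 a b c e J"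
      using q t bspec[OF D q] by (intro exI[of _ a] exI[of _ b] exI[of _ c] exI[of _ e] exI[of _ J]) (simp add: F_def)
  qed
  have equiv: "equiv (weak_GP H M) ?R" by (rule equiv_rescaling_rel) (rule hyperfield_axioms)
  \<comment> \<open>\<open>F\<close> is evaluated at one representative per class; by
    \<open>det\<close>, equal values put the representatives, hence the classes, together.\<close>
  define rep where "rep A = (SOME \<phi>. \<phi> \<in> A)" for A :: "('a list \<Rightarrow> 'h) set"
  have rep: "rep A \<in> A" "A \<subseteq> weak_GP H M" if "A \<in> rescaling_classes H M" for A
  proof -
    have "A \<noteq> {}" using that in_quotient_imp_non_empty[OF equiv] by (simp add: rescaling_classes_def)
    then show "rep A \<in> A" unfolding rep_def by (simp add: some_in_eq)
    show "A \<subseteq> weak_GP H M"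
      using that in_quotient_imp_subset[OF equiv] by (simp add: rescaling_classes_def)
  qed
  have "inj_on (F \<circ> rep) (rescaling_classes H M)"
  proof (rule inj_onI)
    fix A B assume A: "A \<in> rescaling_classes H M" and B: "B \<in> rescaling_classes H M"
      and eq: "(F \<circ> rep) A = (F \<circ> rep) B"
    have "(rep A, rep B) \<in> ?R" using det rep[OF A] rep[OF B] eq by auto
    then show "A = B"
      using quotient_eq_iff[OF equiv _ _ rep(1)[OF A] rep(1)[OF B]] A B by (simp add: rescaling_classes_def)
  qed
  moreover have "(F \<circ> rep) ` rescaling_classes H M \<subseteq> ?Q \<rightarrow>\<^sub>E X_set H"
    using F rep by fastforce
  moreover have finQ: "finite ?Q" by (rule finite_dim1_quads[OF matroid_axioms])
  moreover have "finite (?Q \<rightarrow>\<^sub>E X_set H)"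
    using finite_X_set[OF assms] finQ by (intro finite_PiE) auto
  ultimately have "card (rescaling_classes H M) \<le> card (?Q \<rightarrow>\<^sub>E X_set H)"
    using card_inj_on_le by blast
  also have "\<dots> = card (X_set H) ^ num_dim1_quads M"
    using finQ by (simp add: card_PiE num_dim1_quads_def)
  finally show ?thesis .
qed

end

theorem proposition4p14:
  fixes M :: "'a indep_system"
    and H :: "('h, 'm) hyperstruct_scheme"
  assumes "matroid M"
    and "\<And>N. is_minor N M \<Longrightarrow> \<not> matroid_isomorphic N fano \<and> \<not> matroid_isomorphic N (dual_matroid fano)"
    and "wam_hyperfield H"
    and "finite (carrier H)"
  shows "card (rescaling_classes H M) \<le> card (X_set H) ^ num_dim1_quads M"
proof -
  interpret matroid M by fact
  interpret wam_hyperfield H by fact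
  interpret gp_setting M H by unfold_locales
  show ?thesis by (rule card_rescaling_classes_le) fact
qed

end
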